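(* Let $p\in(0,1]$ and $\psi\in L^p(\mathbb{R}^d)$, and suppose that $\|\lambda P\psi(b\,\cdot)-1\|_{L^p(\mathcal{C})}<1$ for some $\lambda\in\mathbb{C}$. Then for all $f\in L^p(\mathbb{R}^d)$, $$\|f\|_p\approx\inf\left\{\|c\|_{\ell^p(\mathbb{Z}_+\times\mathbb{Z}^d)}:c\in\ell^p(\mathbb{Z}_+\times\mathbb{Z}^d),\ f=Sc\right\}.$$
   Context: Fix a dimension $d\in\mathbb{N}$. Functions and sequences are complex valued. $\mathbb{Z}_+=\{j\in\mathbb{Z}:j>0\}$, $\mathcal{C}=[0,1)^d$. Fix invertible real $d\times d$ matrices $a_j$ ($j\in\mathbb{Z}_+$) with $\|a_j^{-1}\|\to0$ as $j\to\infty$ (operator norm), and an invertible real $d\times d$ matrix $b$. $\|f\|_p=(\int_{\mathbb{R}^d}|f|^p\,dx)^{1/p}$ (and $\|\cdot\|_{L^p(\mathcal{C})}$ is the same with integration over $\mathcal{C}$). $\ell^p(\mathbb{Z}_+\times\mathbb{Z}^d)$ is the space of sequences $c=\{c_{j,k}\}_{j>0,k\in\mathbb{Z}^d}$ with $\|c\|_{\ell^p(\mathbb{Z}_+\times\mathbb{Z}^d)}=(\sum_{j>0}\sum_{k}|c_{j,k}|^p)^{1/p}<\infty$. $\psi_{j,k}(x)=|\det a_j|^{1/p}\psi(a_jx-bk)$, and $Sc=\sum_{j>0}\sum_{k\in\mathbb{Z}^d}c_{j,k}\psi_{j,k}$ (the series converges absolutely a.e. to a function in $L^p$ for $c\in\ell^p(\mathbb{Z}_+\times\mathbb{Z}^d)$).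 Periodization: $P\psi(x)=|\det b|\sum_{k\in\mathbb{Z}^d}\psi(x-bk)$, which converges absolutely a.e.; $P\psi(b\,\cdot)$ denotes $x\mapsto(P\psi)(bx)$, which belongs to $L^p(\mathcal{C})$. $A(f)\approx B(f)$ means there are constants $C_1,C_2>0$, depending only on $\psi$, $b$ and $p$ (not on $f$), with $C_1A(f)\le B(f)\le C_2A(f)$. *)

theory Defs
  imports "HOL-Analysis.Analysis"
begin

text \<open>
  The dimension is \<open>CARD('n)\<close>. Elements of \<open>L\<^sup>p\<close> are represented by measurable functions, so
  equality in \<open>L\<^sup>p\<close> is equality almost everywhere. For \<open>p < 1\<close> the functionals below are
  quasi-norms.
\<close>

definition Lp_space :: "'a measure \<Rightarrow> real \<Rightarrow> ('a \<Rightarrow> complex) set" where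
  "Lp_space M p = {f \<in> borel_measurable M. integrable M (\<lambda>x. cmod (f x) powr p)}"

definition Lp_norm :: "'a measure \<Rightarrow> real \<Rightarrow> ('a \<Rightarrow> complex) \<Rightarrow> real" where
  "Lp_norm M p f = (\<integral>x. cmod (f x) powr p \<partial>M) powr (1 / p)"

definition unit_cell :: "(real ^ 'n) set" where
  "unit_cell = {x. \<forall>i. 0 \<le> x $ i \<and> x $ i < 1}"

definition of_int_vec :: "int ^ 'n \<Rightarrow> real ^ 'n" where
  "of_int_vec k = (\<chi> i. of_int (k $ i))"

text \<open>
  Coefficient families are total functions on \<open>nat \<times> (int ^ 'n)\<close>, but only their values at
  scales \<open>j > 0\<close> are ever used.
\<close>

definition scale_shift_index :: "(nat \<times> (int ^ 'n)) set" where
  "scale_shift_index = {0<..} \<times> UNIV"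

definition lp_space :: "real \<Rightarrow> (nat \<times> (int ^ 'n) \<Rightarrow> complex) set" where
  "lp_space p = {c. (\<lambda>i. cmod (c i) powr p) summable_on scale_shift_index}"

definition lp_norm :: "real \<Rightarrow> (nat \<times> (int ^ 'n) \<Rightarrow> complex) \<Rightarrow> real" where
  "lp_norm p c = (\<Sum>\<^sub>\<infinity>i\<in>scale_shift_index. cmod (c i) powr p) powr (1 / p)"

definition affine_atom ::
  "real \<Rightarrow> (nat \<Rightarrow> real ^ 'n ^ 'n) \<Rightarrow> real ^ 'n ^ 'n \<Rightarrow> (real ^ 'n \<Rightarrow> complex)
     \<Rightarrow> nat \<Rightarrow> int ^ 'n \<Rightarrow> real ^ 'n \<Rightarrow> complex" where
  "affine_atom p a b \<psi> j k x =
     of_real (\<bar>det (a j)\<bar> powr (1 / p)) * \<psi> (a j *v x - b *v of_int_vec k)"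

text \<open>
  In the next two definitions the sums are unordered, hence absolutely convergent wherever they
  converge. For \<open>0 < p \<le> 1\<close>, \<open>\<psi> \<in> L\<^sup>p\<close> and \<open>c \<in> \<ell>\<^sup>p\<close> they converge for almost
  every \<open>x\<close>, so the default value 0 of \<^const>\<open>infsum\<close> is relevant only on a null set.
\<close>

definition synthesis ::
  "real \<Rightarrow> (nat \<Rightarrow> real ^ 'n ^ 'n) \<Rightarrow> real ^ 'n ^ 'n \<Rightarrow> (real ^ 'n \<Rightarrow> complex)
     \<Rightarrow> (nat \<times> (int ^ 'n) \<Rightarrow> complex) \<Rightarrow> real ^ 'n \<Rightarrow> complex" where
  "synthesis p a b \<psi> c x =
     (\<Sum>\<^sub>\<infinity>(j, k)\<in>scale_shift_index. c (j, k) * affine_atom p a b \<psi> j k x)"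

definition periodization ::
  "real ^ 'n ^ 'n \<Rightarrow> (real ^ 'n \<Rightarrow> complex) \<Rightarrow> real ^ 'n \<Rightarrow> complex" where
  "periodization b \<psi> x = of_real \<bar>det b\<bar> * (\<Sum>\<^sub>\<infinity>k. \<psi> (x - b *v of_int_vec k))"

text \<open>
  The infimum is taken in the extended reals, so that it is \<open>\<infinity>\<close> if \<open>f\<close> has no representation.
\<close>

definition synthesis_norm ::
  "real \<Rightarrow> (nat \<Rightarrow> real ^ 'n ^ 'n) \<Rightarrow> real ^ 'n ^ 'n \<Rightarrow> (real ^ 'n \<Rightarrow> complex)
     \<Rightarrow> (real ^ 'n \<Rightarrow> complex) \<Rightarrow> ereal" where
  "synthesis_norm p a b \<psi> f =
     (INF c\<in>{c \<in> lp_space p. AE x in lebesgue. f x = synthesis p a b \<psi> c x}. ereal (lp_norm p c))"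

end

theory Submission imports Defs begin

text \<open>
  Since \<open>p \<le> 1\<close>, the functional \<open>\<integral>|f|\<^sup>p\<close> is subadditive, even over countable sums. This gives
  \<open>\<parallel>Sc\<parallel>\<^sub>p \<le> \<parallel>\<psi>\<parallel>\<^sub>p \<parallel>c\<parallel>\<^sub>p\<close>, hence the lower bound.

  For the upper bound it suffices to find, for every \<open>f\<close>, coefficients with \<open>\<parallel>c\<parallel>\<^sub>p \<le> K \<parallel>f\<parallel>\<^sub>p\<close> such
  that \<open>\<integral>|f - Sc|\<^sup>p\<close> is at most a fixed fraction of \<open>\<integral>|f|\<^sup>p\<close>: iterating on the remainder and
  summing the coefficients represents \<open>f\<close> exactly. Approximate \<open>f\<close> by a continuous \<open>g\<close> with compact
  support and use a single fine scale \<open>j\<close>, with samples of \<open>g\<close> at the points \<open>T k\<close>,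
  \<open>T = a\<^sub>j\<^sup>-\<^sup>1 b\<close>, as coefficients (suitably normalized). In the coordinates \<open>x = T u\<close> the function
  \<open>g\<close> is nearly constant on the cells \<open>n + [0,1)\<^sup>d\<close>, and replacing it by the step function of its
  samples turns \<open>Sc - g\<close> into \<open>g (\<lambda> P\<psi>(b u) - 1)\<close>; by periodicity the \<open>p\<close>-th power integral
  of the latter is that of \<open>g\<close> times \<open>\<parallel>\<lambda> P\<psi>(b \<cdot>) - 1\<parallel>\<^sup>p < 1\<close>. The error made by this replacement is
  controlled by translation differences of the sampled function, which tend to 0.
\<close>

subsection \<open>Linear change of variables\<close>

text \<open>
  The library computes the measure of a linear image only for index types with a well-order, so the
  result is transported to an arbitrary finite index type along an ordered copy of it.
\<close>

typedef ('n::finite) ordered_copy = "{..<CARD('n)}"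
  by (auto intro: exI[of _ 0])

instantiation ordered_copy :: (finite) linorder
begin
definition "x \<le> y \<longleftrightarrow> Rep_ordered_copy x \<le> Rep_ordered_copy y"
definition "x < y \<longleftrightarrow> Rep_ordered_copy x < Rep_ordered_copy y"
instance
  by standard (auto simp: less_eq_ordered_copy_def less_ordered_copy_def Rep_ordered_copy_inject)
end

lemma card_ordered_copy: "CARD('n::finite ordered_copy) = CARD('n)"
  using type_definition.card[OF type_definition_ordered_copy] by simp

instance ordered_copy :: (finite) finite
  by standard (metis card_ordered_copy card_eq_0_iff finite_UNIV_card_ge_0 finite neq0_conv)

instance ordered_copy :: (finite) wellorder
proof -
  have "wf {(x :: 'a ordered_copy, y). x < y}"
    by (rule wf_subset[OF wf_measure[of Rep_ordered_copy]]) (auto simp: less_ordered_copy_def)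
  then show "OFCLASS('a ordered_copy, wellorder_class)"
    by (rule wf_wellorderI) intro_classes
qed

text \<open>Conjugation by \<open>e\<close> is a bijection between the permutations of the two index
  types; it preserves signs and matches the products in the Leibniz formula term by term.\<close>

lemma det_reindex:
  fixes A :: "real ^ 'n ^ 'n" and e :: "'m::finite \<Rightarrow> 'n"
  assumes e: "bij e"
  shows "det (\<chi> i j. A $ e i $ e j) = det A"
proof -
  have inj: "inj_on e UNIV" and bb: "bij_betw e UNIV UNIV"
    using e by (auto simp: bij_def)
  \<comment> \<open>On a whole type \<open>map_permutation\<close> is the conjugate
    \<open>f o q o inv f\<close>, so both inverse laws below follow by cancellation.\<close>
  have conj: "map_permutation UNIV f q y = f (q (inv f y))"
    if "bij f" for f :: "'a \<Rightarrow> 'b" and q y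
    using that map_permutation_apply[of f UNIV "inv f y" q]
    by (simp add: bij_is_inj bij_is_surj surj_f_inv_f)
  have *: "bij_betw (map_permutation UNIV e) {p. p permutes UNIV} {p. p permutes UNIV}"
  proof (rule bij_betw_byWitness[where f' = "map_permutation UNIV (inv e)"])
    show "\<forall>p\<in>{p. p permutes UNIV}. map_permutation UNIV (inv e) (map_permutation UNIV e p) = p"
      using conj[OF e] conj[OF bij_imp_bij_inv[OF e]] e by (auto simp: fun_eq_iff inv_inv_eq bij_is_inj)
    show "\<forall>p\<in>{p. p permutes UNIV}. map_permutation UNIV e (map_permutation UNIV (inv e) p) = p"
      using conj[OF e] conj[OF bij_imp_bij_inv[OF e]] e by (auto simp: fun_eq_iff inv_inv_eq bij_is_surj surj_f_inv_f)
    show "map_permutation UNIV e ` {p. p permutes UNIV} \<subseteq> {p. p permutes UNIV}"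
      using bb by (auto intro: map_permutation_permutes)
    show "map_permutation UNIV (inv e) ` {p. p permutes UNIV} \<subseteq> {p. p permutes UNIV}"
      using e by (auto intro!: map_permutation_permutes[where A=UNIV] bij_imp_bij_inv)
  qed
  have "det A = (\<Sum>p\<in>{p. p permutes UNIV}. of_int (sign (map_permutation UNIV e p)) * (\<Prod>i\<in>UNIV. A $ i $ map_permutation UNIV e p i))"
    unfolding det_def by (rule sum.reindex_bij_betw[OF *, symmetric])
  also have "\<dots> = (\<Sum>p\<in>{p. p permutes UNIV}. of_int (sign p) * (\<Prod>i\<in>UNIV. A $ e i $ e (p i)))"
  proof (rule sum.cong[OF refl], clarify)
    fix p :: "'m \<Rightarrow> 'm" assume p: "p permutes UNIV"
    have "(\<Prod>i\<in>UNIV. A $ i $ map_permutation UNIV e p i) = (\<Prod>i\<in>UNIV. A $ e i $ map_permutation UNIV e p (e i))"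
      by (rule prod.reindex_bij_betw[OF bb, symmetric])
    then show "of_int (sign (map_permutation UNIV e p)) * (\<Prod>i\<in>UNIV. A $ i $ map_permutation UNIV e p i) = of_int (sign p) * (\<Prod>i\<in>UNIV. A $ e i $ e (p i))"
      using sign_map_permutation[OF inj p] by (simp add: map_permutation_apply[OF inj])
  qed
  finally show ?thesis by (simp add: det_def)
qed

definition reindex :: "('m::finite \<Rightarrow> 'n::finite) \<Rightarrow> real ^ 'n \<Rightarrow> real ^ 'm" where
  "reindex e x = (\<chi> i. x $ e i)"

lemma linear_reindex: "linear (reindex e)"
  by (auto simp: reindex_def vec_eq_iff intro!: linearI)

lemma borel_reindex [measurable]: "reindex e \<in> borel \<rightarrow>\<^sub>M borel"
  using linear_continuous_on[OF linear_linear[THEN iffD2, OF linear_reindex]]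
  by (intro borel_measurable_continuous_onI) auto

lemma prod_Basis_cart: "(\<Prod>b\<in>Basis. x \<bullet> b) = (\<Prod>i\<in>UNIV. x $ i)" for x :: "real ^ 'n"
proof -
  have "bij_betw (\<lambda>i. axis i (1::real)) (UNIV::'n set) Basis"
    by (auto simp: bij_betw_def inj_on_def axis_eq_axis Basis_vec_def)
  from prod.reindex_bij_betw[OF this, of "\<lambda>b. x \<bullet> b"] show ?thesis
    by (simp add: inner_axis)
qed

text \<open>Lebesgue measure is determined by its values on boxes, and the preimage of a box is a
  box with the same side lengths in another order.\<close>

lemma distr_lborel_reindex:
  fixes e :: "'m::finite \<Rightarrow> 'n::finite"
  assumes e: "bij e"
  shows "distr lborel borel (reindex e) = lborel"
proof (rule lborel_eqI[symmetric])
  fix l u :: "real ^ 'm" assume le: "\<And>b. b \<in> Basis \<Longrightarrow> l \<bullet> b \<le> u \<bullet> b"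
  then have le': "l $ i \<le> u $ i" for i
    by (metis axis_in_Basis_iff inner_axis inner_real_def mult.right_neutral Basis_real_def insertI1)
  have vim: "reindex e -` box l u = box (reindex (inv e) l) (reindex (inv e) u)"
  proof (rule set_eqI, goal_cases)
    case (1 x)
    have "(\<forall>i. l $ i < x $ e i \<and> x $ e i < u $ i) \<longleftrightarrow> (\<forall>i. l $ inv e i < x $ i \<and> x $ i < u $ inv e i)"
      by (metis e bij_inv_eq_iff)
    then show ?case by (simp add: mem_box_cart reindex_def)
  qed
  have "emeasure (distr lborel borel (reindex e)) (box l u) = emeasure lborel (box (reindex (inv e) l) (reindex (inv e) u))"
    by (simp add: emeasure_distr vim)
  also have "\<dots> = ennreal (\<Prod>b\<in>Basis. (reindex (inv e) u - reindex (inv e) l) \<bullet> b)"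
    using le' by (intro emeasure_lborel_box) (auto simp: Basis_vec_def inner_axis reindex_def)
  also have "(\<Prod>b\<in>Basis. (reindex (inv e) u - reindex (inv e) l) \<bullet> b) = (\<Prod>i\<in>UNIV. (u - l) $ inv e i)"
    by (simp add: prod_Basis_cart reindex_def)
  also have "\<dots> = (\<Prod>i\<in>UNIV. (u - l) $ i)"
    by (rule prod.reindex_bij_betw) (use e in \<open>auto intro: bij_imp_bij_inv\<close>)
  also have "\<dots> = (\<Prod>b\<in>Basis. (u - l) \<bullet> b)"
    by (simp only: prod_Basis_cart)
  finally show "emeasure (distr lborel borel (reindex e)) (box l u) = ennreal (\<Prod>b\<in>Basis. (u - l) \<bullet> b)" .
qed simp

lemma borel_mat_mult [measurable]: "(\<lambda>x. A *v x) \<in> borel \<rightarrow>\<^sub>M borel" for A :: "real ^ 'n ^ 'm"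
  by (intro borel_measurable_continuous_onI linear_continuous_on matrix_vector_mul_bounded_linear)

section \<open>Inverse matrices\<close>

lemma matrix_inv_right: "A ** matrix_inv A = mat 1"
  and matrix_inv_left: "matrix_inv A ** A = mat 1"
  if "invertible A" for A :: "'a::semiring_1 ^ 'n ^ 'm"
  using someI_ex[OF that[unfolded invertible_def]] by (auto simp: matrix_inv_def)

lemma matrix_inv_cancel:
  fixes A :: "real ^ 'n ^ 'n"
  assumes "invertible A"
  shows "A *v (matrix_inv A *v x) = x" "matrix_inv A *v (A *v x) = x"
  using assms by (simp_all add: matrix_vector_mul_assoc matrix_inv_left matrix_inv_right)

lemma invertible_matrix_inv: "invertible A \<Longrightarrow> invertible (matrix_inv A)" for A :: "real ^ 'n ^ 'n"
  unfolding invertible_def using matrix_inv_left[of A] matrix_inv_right[of A] invertible_def by metis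

lemma det_matrix_inv: "invertible A \<Longrightarrow> det (matrix_inv A) = 1 / det A" for A :: "real ^ 'n ^ 'n"
  by (metis det_I det_mul invertible_det_nz matrix_inv_left nonzero_eq_divide_eq)

text \<open>Tested on boxes: the preimage of a box under \<open>A\<close> is its image under the
  inverse matrix, whose measure carries the factor 1 / |det A|; the density undoes it.\<close>

lemma lborel_linear_wellorder:
  fixes A :: "real ^ 'n::{finite,wellorder} ^ 'n::_"
  assumes A: "invertible A"
  shows "density (distr lborel borel (\<lambda>x. A *v x)) (\<lambda>_. ennreal \<bar>det A\<bar>) = lborel"
proof (rule lborel_eqI[symmetric])
  fix l u :: "real ^ 'n::{finite,wellorder}"
  assume le: "\<And>b. b \<in> Basis \<Longrightarrow> l \<bullet> b \<le> u \<bullet> b"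
  define B where "B = (\<lambda>x. A *v x) -` box l u"
  have B: "B = (\<lambda>x. matrix_inv A *v x) ` box l u"
    unfolding B_def by (force simp: matrix_inv_cancel[OF A])
  have lin: "linear (\<lambda>x. matrix_inv A *v x)" by simp
  have Bm: "B \<in> lmeasurable" and Bm': "measure lebesgue B = \<bar>det (matrix_inv A)\<bar> * measure lebesgue (box l u)"
    unfolding B using measurable_linear_image[OF lin lmeasurable_box] measure_linear_image[OF lin lmeasurable_box] by auto
  have Bb: "B \<in> sets borel" unfolding B_def by (rule measurable_sets_borel[OF borel_mat_mult]) simp
  have "det A * det (matrix_inv A) = 1"
    by (metis A det_I det_mul matrix_inv_right)
  then have "\<bar>det A\<bar> * \<bar>det (matrix_inv A)\<bar> = 1" by (metis abs_1 abs_mult)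
  then have d: "\<bar>det A\<bar> * (\<bar>det (matrix_inv A)\<bar> * t) = t" for t :: real
    by (metis mult.assoc mult_1)
  have "emeasure lborel B = ennreal (measure lebesgue B)"
    using emeasure_eq_measure2[OF Bm] Bb by simp
  then have "ennreal \<bar>det A\<bar> * emeasure lborel B = ennreal (measure lborel (box l u))"
    unfolding Bm' by (simp add: ennreal_mult'[symmetric] d)
  moreover have "ennreal (measure lborel (box l u)) = ennreal (\<Prod>b\<in>Basis. (u - l) \<bullet> b)"
    using le by (simp add: measure_lborel_box)
  ultimately show "emeasure (density (distr lborel borel (\<lambda>x. A *v x)) (\<lambda>_. ennreal \<bar>det A\<bar>)) (box l u) = ennreal (\<Prod>b\<in>Basis. (u - l) \<bullet> b)"
    by (simp add: emeasure_density nn_integral_cmult emeasure_distr B_def nn_integral_cmult_indicator)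
qed simp

lemma reindex_mat_mult:
  assumes "bij e"
  shows "reindex (inv e) ((\<chi> i j. A $ e i $ e j) *v reindex e x) = A *v x"
proof -
  have "(\<Sum>j\<in>UNIV. A $ i $ e j * x $ e j) = (\<Sum>j\<in>UNIV. A $ i $ j * x $ j)" for i
    using assms by (intro sum.reindex_bij_betw) auto
  then show ?thesis
    using assms by (simp add: vec_eq_iff reindex_def matrix_vector_mult_def bij_is_surj surj_f_inv_f)
qed

text \<open>\<open>A\<close> factors through the ordered copy as \<open>reindex e\<close>, then
  \<open>B\<close>, then \<open>reindex (inv e)\<close>. The outer maps preserve Lebesgue measure,
  and \<open>B\<close> has the determinant of \<open>A\<close>.\<close>

lemma lborel_linear:
  fixes A :: "real ^ 'n ^ 'n"
  assumes A: "invertible A"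
  shows "density (distr lborel borel (\<lambda>x. A *v x)) (\<lambda>_. ennreal \<bar>det A\<bar>) = lborel"
proof -
  have "card (UNIV :: 'n ordered_copy set) = card (UNIV :: 'n set)"
    by (rule card_ordered_copy)
  then obtain e :: "'n ordered_copy \<Rightarrow> 'n" where e: "bij e"
    using finite_same_card_bij[of "UNIV :: 'n ordered_copy set" "UNIV :: 'n set"] by auto
  define B where "B = (\<chi> i j. A $ e i $ e j)"
  have dB: "det B = det A" unfolding B_def by (rule det_reindex[OF e])
  have B: "invertible B" using A by (simp add: invertible_det_nz dB)
  have ie: "bij (inv e)" using e by (rule bij_imp_bij_inv)
  have "distr lborel borel (\<lambda>x. A *v x) = distr (distr (distr lborel borel (reindex e)) borel (\<lambda>x. B *v x)) borel (reindex (inv e))"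
    using reindex_mat_mult[OF e, of A] by (simp add: distr_distr B_def comp_def)
  also have "\<dots> = distr (distr lborel borel (\<lambda>x. B *v x)) borel (reindex (inv e))"
    by (simp add: distr_lborel_reindex[OF e])
  finally have "density (distr lborel borel (\<lambda>x. A *v x)) (\<lambda>_. ennreal \<bar>det A\<bar>) =
     distr (density (distr lborel borel (\<lambda>x. B *v x)) (\<lambda>_. ennreal \<bar>det A\<bar>)) borel (reindex (inv e))"
    by (simp add: density_distr)
  also have "\<dots> = distr lborel borel (reindex (inv e))"
    using lborel_linear_wellorder[OF B] by (simp add: dB)
  finally show ?thesis by (simp add: distr_lborel_reindex[OF ie])
qed

text \<open>Since det A is nonzero, \<open>lborel\<close> and its image under \<open>A\<close> have
  the same null sets. Hence completion commutes with forming the image measure, which lifts the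
  Borel statement to \<open>lebesgue\<close> and makes the map measurable there.\<close>

lemma
  fixes A :: "real ^ 'n ^ 'n"
  assumes A: "invertible A"
  shows measurable_lebesgue_linear: "(\<lambda>x. A *v x) \<in> lebesgue \<rightarrow>\<^sub>M lebesgue"
    and lebesgue_linear: "density (distr lebesgue lebesgue (\<lambda>x. A *v x)) (\<lambda>_. ennreal \<bar>det A\<bar>) = lebesgue"
proof -
  let ?T = "\<lambda>x. A *v x"
  have d: "det A \<noteq> 0" using A by (simp add: invertible_det_nz)
  { fix N :: "(real ^ 'n) set" assume N: "N \<in> sets borel"
    then have "emeasure lborel N = 0 \<longleftrightarrow> emeasure (density (distr lborel borel ?T) (\<lambda>_. ennreal \<bar>det A\<bar>)) N = 0"
      by (simp add: lborel_linear[OF A])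
    also have "\<dots> \<longleftrightarrow> emeasure (distr lebesgue lborel ?T) N = 0"
      using N d by (simp add: distr_completion emeasure_density nn_integral_cmult cong: distr_cong)
    finally have "emeasure lborel N = 0 \<longleftrightarrow> emeasure (distr lebesgue lborel ?T) N = 0" . }
  then have eq: "null_sets lborel = null_sets (distr lebesgue lborel ?T)"
    by (auto simp: null_sets_def)
  show "?T \<in> lebesgue \<rightarrow>\<^sub>M lebesgue"
    by (simp add: completion.measurable_completion2 eq measurable_completion)
  have "lebesgue = completion (density (distr lborel borel ?T) (\<lambda>_. ennreal \<bar>det A\<bar>))"
    by (simp add: lborel_linear[OF A])
  also have "\<dots> = density (completion (distr lebesgue lborel ?T)) (\<lambda>_. ennreal \<bar>det A\<bar>)"
    using d by (auto intro!: always_eventually completion_density_eq simp: distr_completion cong: distr_cong)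
  also have "\<dots> = density (distr lebesgue lebesgue ?T) (\<lambda>_. ennreal \<bar>det A\<bar>)"
    by (subst completion.completion_distr_eq) (auto simp: eq measurable_completion)
  finally show "density (distr lebesgue lebesgue ?T) (\<lambda>_. ennreal \<bar>det A\<bar>) = lebesgue" by simp
qed

section \<open>Substitution rules for Lebesgue integrals\<close>

lemma measurable_lebesgue_translation: "(\<lambda>x. t + x) \<in> lebesgue \<rightarrow>\<^sub>M lebesgue"
  for t :: "'a::euclidean_space"
  using lebesgue_affine_measurable[of "\<lambda>_. 1" t] by (simp add: euclidean_representation)

lemma lebesgue_translation: "distr lebesgue lebesgue (\<lambda>x. t + x) = lebesgue"
  for t :: "'a::euclidean_space"
  using lebesgue_affine_euclidean[of "\<lambda>_. 1" t] by (simp add: euclidean_representation density_1)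

lemma nn_integral_lebesgue_linear:
  fixes A :: "real ^ 'n ^ 'n"
  assumes A: "invertible A" and f: "f \<in> borel_measurable lebesgue"
  shows "(\<integral>\<^sup>+x. f x \<partial>lebesgue) = ennreal \<bar>det A\<bar> * (\<integral>\<^sup>+x. f (A *v x) \<partial>lebesgue)"
proof -
  note [measurable] = measurable_lebesgue_linear[OF A] f
  have "(\<integral>\<^sup>+x. f x \<partial>lebesgue) = (\<integral>\<^sup>+x. f x \<partial>density (distr lebesgue lebesgue (\<lambda>x. A *v x)) (\<lambda>_. ennreal \<bar>det A\<bar>))"
    by (simp only: lebesgue_linear[OF A])
  also have "\<dots> = ennreal \<bar>det A\<bar> * (\<integral>\<^sup>+x. f (A *v x) \<partial>lebesgue)"
    by (subst nn_integral_density; simp add: nn_integral_distr nn_integral_cmult)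
  finally show ?thesis .
qed

lemma nn_integral_lebesgue_translation:
  fixes t :: "'a::euclidean_space"
  assumes f: "f \<in> borel_measurable lebesgue"
  shows "(\<integral>\<^sup>+x. f (t + x) \<partial>lebesgue) = (\<integral>\<^sup>+x. f x \<partial>lebesgue)"
proof -
  note [measurable] = measurable_lebesgue_translation f
  have "(\<integral>\<^sup>+x. f x \<partial>lebesgue) = (\<integral>\<^sup>+x. f x \<partial>distr lebesgue lebesgue (\<lambda>x. t + x))"
    by (simp only: lebesgue_translation)
  then show ?thesis by (simp add: nn_integral_distr)
qed

subsection \<open>Powers of the modulus and unordered sums\<close>

text \<open>Valued in the extended nonnegative reals, so that Tonelli exchanges and countable sums
  need no integrability assumptions.\<close>

definition ppow :: "real \<Rightarrow> complex \<Rightarrow> ennreal" where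
  "ppow p z = ennreal (cmod z powr p)"

text \<open>After division by x + y the two terms lie in [0,1] and add up to 1; there t \<le> t powr
  p because p \<le> 1.\<close>

lemma powr_add_le:
  fixes x y p :: real
  assumes p: "0 < p" "p \<le> 1" and "0 \<le> x" "0 \<le> y"
  shows "(x + y) powr p \<le> x powr p + y powr p"
proof (cases "x + y = 0")
  case False
  define s where "s = x + y"
  have s: "s > 0" using False assms by (simp add: s_def)
  have "x / s \<le> (x / s) powr p" "y / s \<le> (y / s) powr p"
    using powr_mono'[of p 1 "x / s"] powr_mono'[of p 1 "y / s"] assms s by (auto simp: s_def)
  moreover have "x / s + y / s = 1" using s by (simp add: s_def add_divide_distrib[symmetric])
  ultimately have "1 \<le> (x / s) powr p + (y / s) powr p" by linarith
  then have "s powr p * 1 \<le> s powr p * ((x / s) powr p + (y / s) powr p)"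
    by (intro mult_left_mono) auto
  also have "\<dots> = x powr p + y powr p"
    using s assms by (simp add: powr_divide distrib_left)
  finally show ?thesis by (simp add: s_def)
qed (use assms in auto)

lemma powr_sum_le:
  fixes f :: "'a \<Rightarrow> real"
  assumes p: "0 < p" "p \<le> 1" and f: "\<And>i. i \<in> A \<Longrightarrow> 0 \<le> f i"
  shows "(\<Sum>i\<in>A. f i) powr p \<le> (\<Sum>i\<in>A. f i powr p)"
  using f
proof (induction A rule: infinite_finite_induct)
  case (insert i A)
  then show ?case
    using powr_add_le[OF p, of "f i" "sum f A"] by (simp add: sum_nonneg)
qed (use p in auto)

context
  fixes p :: real
  assumes p: "0 < p" "p \<le> 1"
begin

lemma ppow_0 [simp]: "ppow p 0 = 0"
  using p by (simp add: ppow_def)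

lemma ppow_add_le: "ppow p (z + w) \<le> ppow p z + ppow p w"
proof -
  have "cmod (z + w) powr p \<le> (cmod z + cmod w) powr p"
    using p by (intro powr_mono2) (auto simp: norm_triangle_ineq)
  also have "\<dots> \<le> cmod z powr p + cmod w powr p" by (rule powr_add_le) (use p in auto)
  finally show ?thesis by (simp add: ppow_def ennreal_leI flip: ennreal_plus)
qed

lemma ppow_minus [simp]: "ppow p (- z) = ppow p z"
  by (simp add: ppow_def)

lemma ppow_diff_le: "ppow p (z - w) \<le> ppow p z + ppow p w"
  using ppow_add_le[of z "- w"] by simp

lemma ppow_minus_commute: "ppow p (z - w) = ppow p (w - z)"
  by (simp add: ppow_def norm_minus_commute)

lemma ppow_mult: "ppow p (z * w) = ppow p z * ppow p w"
  using p by (simp add: ppow_def norm_mult powr_mult ennreal_mult)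

lemma ppow_less_top [simp]: "ppow p z < top"
  by (simp add: ppow_def)

lemma ppow_mono: "cmod z \<le> cmod w \<Longrightarrow> ppow p z \<le> ppow p w"
  using p by (auto simp: ppow_def intro!: ennreal_leI powr_mono2)

lemma measurable_ppow [measurable]: "ppow p \<in> borel_measurable borel"
  unfolding ppow_def by measurable

lemma tendsto_ppow_0:
  assumes "(f \<longlongrightarrow> 0) F"
  shows "((\<lambda>x. ppow p (f x)) \<longlongrightarrow> 0) F"
proof -
  have "((\<lambda>x. cmod (f x) powr p) \<longlongrightarrow> 0 powr p) F"
    using p by (intro tendsto_powr' tendsto_const tendsto_norm_zero assms) auto
  from tendsto_ennrealI[OF this] show ?thesis unfolding ppow_def using p by simp
qed

text \<open>This is the inclusion of l^p in l^1 for p \<le> 1: finite subadditivity bounds every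
  finite sum of moduli by the same number \<open>B powr (1 / p)\<close>, hence also the infinite
  sum.\<close>

lemma abs_summable_ppow:
  assumes "(\<integral>\<^sup>+i. ppow p (f i) \<partial>count_space A) < top"
  shows "(\<lambda>i. cmod (f i)) summable_on A"
    and "ennreal ((\<Sum>\<^sub>\<infinity>i\<in>A. cmod (f i)) powr p) \<le> (\<integral>\<^sup>+i. ppow p (f i) \<partial>count_space A)"
proof -
  obtain B where B: "0 \<le> B" "(\<integral>\<^sup>+i. ppow p (f i) \<partial>count_space A) = ennreal B"
    using assms by (cases "\<integral>\<^sup>+i. ppow p (f i) \<partial>count_space A") auto
  have bd: "(\<Sum>i\<in>F. cmod (f i)) \<le> B powr (1 / p)" if F: "finite F" "F \<subseteq> A" for F
  proof -
    have "ennreal (\<Sum>i\<in>F. cmod (f i) powr p) = (\<integral>\<^sup>+i. ppow p (f i) \<partial>count_space F)"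
      using F by (simp add: nn_integral_count_space_finite ppow_def)
    also have "\<dots> = (\<integral>\<^sup>+i. ppow p (f i) * indicator F i \<partial>count_space A)"
      using F by (simp add: nn_integral_count_space_indicator mult.assoc flip: indicator_inter_arith)
                 (simp add: Int_absorb1 Int_commute)
    also have "\<dots> \<le> ennreal B"
      unfolding B(2)[symmetric] by (intro nn_integral_mono) (auto simp: indicator_def)
    finally have "(\<Sum>i\<in>F. cmod (f i) powr p) \<le> B" using B(1) by simp
    then have "(\<Sum>i\<in>F. cmod (f i)) powr p \<le> B"
      using powr_sum_le[OF p, of F "\<lambda>i. cmod (f i)"] by simp
    then have "((\<Sum>i\<in>F. cmod (f i)) powr p) powr (1 / p) \<le> B powr (1 / p)"
      using p by (intro powr_mono2) auto
    then show ?thesis using p by (simp add: powr_powr sum_nonneg)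
  qed
  show s: "(\<lambda>i. cmod (f i)) summable_on A"
    by (rule nonneg_bdd_above_summable_on) (auto intro!: bdd_aboveI2 bd)
  have "(\<Sum>\<^sub>\<infinity>i\<in>A. cmod (f i)) \<le> B powr (1 / p)"
    by (rule infsum_le_finite_sums[OF s]) (use bd in auto)
  then have "(\<Sum>\<^sub>\<infinity>i\<in>A. cmod (f i)) powr p \<le> (B powr (1 / p)) powr p"
    using p by (intro powr_mono2) (auto intro: infsum_nonneg)
  then show "ennreal ((\<Sum>\<^sub>\<infinity>i\<in>A. cmod (f i)) powr p) \<le> (\<integral>\<^sup>+i. ppow p (f i) \<partial>count_space A)"
    using p B by (simp add: powr_powr ennreal_leI)
qed

lemma summable_ppow:
  assumes "(\<integral>\<^sup>+i. ppow p (f i) \<partial>count_space A) < top"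
  shows "f summable_on A"
  using abs_summable_ppow(1)[OF assms] by (simp add: summable_on_iff_abs_summable_on_complex)

text \<open>If the right-hand side is infinite there is nothing to prove; otherwise the series
  converges absolutely and the previous bound applies. So the estimate is available for every
  family.\<close>

lemma ppow_infsum_le: "ppow p (infsum f A) \<le> (\<integral>\<^sup>+i. ppow p (f i) \<partial>count_space A)"
proof (cases "(\<integral>\<^sup>+i. ppow p (f i) \<partial>count_space A) < top")
  case True
  have "cmod (infsum f A) \<le> (\<Sum>\<^sub>\<infinity>i\<in>A. cmod (f i))"
    by (rule norm_infsum_bound[OF abs_summable_ppow(1)[OF True]])
  then have "ppow p (infsum f A) \<le> ennreal ((\<Sum>\<^sub>\<infinity>i\<in>A. cmod (f i)) powr p)"
    using p unfolding ppow_def by (intro ennreal_leI powr_mono2) auto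
  then show ?thesis using abs_summable_ppow(2)[OF True] by order
qed (auto simp: not_less top_unique)

end

text \<open>The default values agree: complex families are summable exactly if they are absolutely
  summable, and otherwise both sides are 0.\<close>

lemma infsum_eq_integral_count_space:
  fixes f :: "'a \<Rightarrow> complex"
  shows "infsum f A = (\<integral>i. f i \<partial>count_space A)"
  by (metis abs_summable_equivalent infsetsum_def infsetsum_infsum infsum_not_exists
      not_summable_infsetsum_eq summable_on_iff_abs_summable_on_complex)

text \<open>A sum over a countable set is an integral against a sigma-finite counting measure, and
  such an integral depends measurably on its parameter, also where the sum diverges and takes its
  default value.\<close>

lemma measurable_infsum:
  fixes f :: "'i \<Rightarrow> 'a \<Rightarrow> complex"
  assumes A: "countable A" and f: "\<And>i. i \<in> A \<Longrightarrow> f i \<in> borel_measurable M"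
  shows "(\<lambda>x. \<Sum>\<^sub>\<infinity>i\<in>A. f i x) \<in> borel_measurable M"
proof -
  interpret sigma_finite_measure "count_space A"
    by (rule sigma_finite_measure_count_space_countable[OF A])
  have "(\<lambda>(x, i). f i x) \<in> borel_measurable (M \<Otimes>\<^sub>M count_space A)"
    unfolding split_beta using f
    by (intro measurable_compose_countable'[where f = "\<lambda>i z. f i (fst z)" and g = snd, OF _ _ A]) auto
  then show ?thesis
    unfolding infsum_eq_integral_count_space by (rule borel_measurable_lebesgue_integral)
qed

lemma measurable_nn_integral_count_space:
  fixes f :: "'i \<Rightarrow> 'a \<Rightarrow> ennreal"
  assumes A: "countable A" and f: "\<And>i. i \<in> A \<Longrightarrow> f i \<in> borel_measurable M"
  shows "(\<lambda>x. \<integral>\<^sup>+i. f i x \<partial>count_space A) \<in> borel_measurable M"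
proof -
  interpret sigma_finite_measure "count_space A"
    by (rule sigma_finite_measure_count_space_countable[OF A])
  have "(\<lambda>(x, i). f i x) \<in> borel_measurable (M \<Otimes>\<^sub>M count_space A)"
    unfolding split_beta using f
    by (intro measurable_compose_countable'[where f = "\<lambda>i z. f i (fst z)" and g = snd, OF _ _ A]) auto
  then show ?thesis by (rule borel_measurable_nn_integral)
qed

lemma nn_integral_count_space_Times:
  fixes f :: "'a \<Rightarrow> 'b \<Rightarrow> ennreal"
  shows "(\<integral>\<^sup>+z. f (fst z) (snd z) \<partial>count_space (A \<times> B)) = (\<integral>\<^sup>+x. \<integral>\<^sup>+y. f x y \<partial>count_space B \<partial>count_space A)"
proof -
  have "(\<integral>\<^sup>+z. f (fst z) (snd z) \<partial>count_space (A \<times> B)) =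
    (\<integral>\<^sup>+z. f (fst z) (snd z) * indicator (A \<times> B) z \<partial>count_space UNIV)"
    by (simp add: nn_integral_count_space_indicator)
  also have "\<dots> = (\<integral>\<^sup>+x. \<integral>\<^sup>+y. f x y * indicator (A \<times> B) (x, y) \<partial>count_space UNIV \<partial>count_space UNIV)"
    by (subst nn_integral_fst_count_space[symmetric]) simp
  also have "\<dots> = (\<integral>\<^sup>+x. (\<integral>\<^sup>+y. f x y * indicator B y \<partial>count_space UNIV) * indicator A x \<partial>count_space UNIV)"
    by (intro nn_integral_cong) (auto simp: indicator_def)
  finally show ?thesis by (simp add: nn_integral_count_space_indicator)
qed

subsection \<open>Decomposition into unit cells\<close>

definition floor_vec :: "real ^ 'n \<Rightarrow> int ^ 'n" where
  "floor_vec x = (\<chi> i. \<lfloor>x $ i\<rfloor>)"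

lemma of_int_vec_add: "of_int_vec (m + n) = of_int_vec m + of_int_vec n"
  and of_int_vec_minus: "of_int_vec (- n) = - of_int_vec n"
  by (simp_all add: of_int_vec_def vec_eq_iff)

lemma diff_mem_unit_cell_iff: "x - of_int_vec n \<in> unit_cell \<longleftrightarrow> floor_vec x = n"
  by (simp add: unit_cell_def of_int_vec_def floor_vec_def vec_eq_iff floor_eq_iff)
     (smt (verit))

lemma floor_vec_add_int: "x \<in> unit_cell \<Longrightarrow> floor_vec (of_int_vec n + x) = n"
  by (simp flip: diff_mem_unit_cell_iff)

lemma unit_cell_borel [measurable]: "unit_cell \<in> sets borel"
proof -
  have "unit_cell = (\<Inter>i. {x :: real ^ 'n. 0 \<le> x $ i} \<inter> {x. x $ i < 1})"
    by (auto simp: unit_cell_def)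
  also have "\<dots> \<in> sets borel"
    by (intro sets.countable_INT'' sets.Int borel_closed borel_open closed_Collect_le open_Collect_less
        continuous_intros) auto
  finally show ?thesis .
qed

lemma unit_cell_lebesgue [measurable]: "unit_cell \<in> sets lebesgue"
  using unit_cell_borel by (metis sets_completionI_sets sets_lborel)

lemma emeasure_unit_cell: "emeasure lebesgue (unit_cell :: (real ^ 'n) set) = 1"
proof (rule antisym)
  have 1: "(\<Prod>b\<in>Basis. ((\<chi> i. 1) - 0 :: real ^ 'n) \<bullet> b) = 1" by (simp only: prod_Basis_cart) simp
  have le: "0 \<bullet> b \<le> (\<chi> i. 1 :: real ^ 'n) \<bullet> b" if "b \<in> Basis" for b :: "real ^ 'n"
    using that by (auto simp: Basis_vec_def inner_axis)
  have "emeasure lebesgue (unit_cell :: (real ^ 'n) set) \<le> emeasure lebesgue (cbox 0 (\<chi> i. 1) :: (real ^ 'n) set)"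
    by (intro emeasure_mono) (auto simp: unit_cell_def mem_box_cart less_imp_le)
  also have "\<dots> = 1" using le 1 by simp
  finally show "emeasure lebesgue (unit_cell :: (real ^ 'n) set) \<le> 1" .
  have "1 = emeasure lebesgue (box 0 (\<chi> i. 1) :: (real ^ 'n) set)"
    using le 1 by simp
  also have "\<dots> \<le> emeasure lebesgue (unit_cell :: (real ^ 'n) set)"
    by (intro emeasure_mono) (auto simp: unit_cell_def mem_box_cart less_imp_le)
  finally show "1 \<le> emeasure lebesgue (unit_cell :: (real ^ 'n) set)" .
qed

lemma measurable_floor_vec [measurable]: "floor_vec \<in> borel \<rightarrow>\<^sub>M count_space UNIV"
proof (rule measurable_count_space_eq_countable[THEN iffD2, rotated 1])
  show "floor_vec \<in> space borel \<rightarrow> UNIV \<and> (\<forall>n\<in>UNIV. floor_vec -` {n} \<inter> space borel \<in> sets borel)"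
  proof (intro conjI ballI)
    fix n :: "int ^ 'n"
    have "floor_vec -` {n} \<inter> space borel = (\<lambda>x. x - of_int_vec n) -` unit_cell \<inter> space borel"
      by (auto simp: diff_mem_unit_cell_iff)
    also have "\<dots> \<in> sets borel" by measurable
    finally show "floor_vec -` {n} \<inter> space borel \<in> sets borel" .
  qed simp
qed simp

lemma measurable_floor_vec_lebesgue [measurable]: "floor_vec \<in> lebesgue \<rightarrow>\<^sub>M count_space UNIV"
  by (rule measurable_completion) simp

text \<open>The fibres of \<open>floor_vec\<close> are the integer translates of the unit cell, so
  they partition the space; the integral over each piece is translated back to the unit
  cell.\<close>

lemma nn_integral_unit_cells:
  fixes h :: "real ^ 'n \<Rightarrow> ennreal"
  assumes h: "h \<in> borel_measurable lebesgue"
  shows "(\<integral>\<^sup>+x. h x \<partial>lebesgue) =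
    (\<integral>\<^sup>+n. \<integral>\<^sup>+x. h (of_int_vec n + x) * indicator unit_cell x \<partial>lebesgue \<partial>count_space UNIV)"
proof -
  have m: "(\<lambda>x. h x * indicator {n} (floor_vec x)) \<in> borel_measurable lebesgue" for n
    using h by measurable
  have "(\<integral>\<^sup>+x. h x \<partial>lebesgue) = (\<integral>\<^sup>+x. \<integral>\<^sup>+n. h x * indicator {n} (floor_vec x) \<partial>count_space UNIV \<partial>lebesgue)"
  proof (rule nn_integral_cong)
    fix x :: "real ^ 'n"
    have "(\<integral>\<^sup>+n. h x * indicator {n} (floor_vec x) \<partial>count_space UNIV) = (\<integral>\<^sup>+n. h x * indicator {floor_vec x} n \<partial>count_space UNIV)"
      by (intro nn_integral_cong) (auto simp: indicator_def)
    then show "h x = (\<integral>\<^sup>+n. h x * indicator {n} (floor_vec x) \<partial>count_space UNIV)" by simp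
  qed
  also have "\<dots> = (\<integral>\<^sup>+n. \<integral>\<^sup>+x. h x * indicator {n} (floor_vec x) \<partial>lebesgue \<partial>count_space UNIV)"
    by (intro nn_integral_count_space_nn_integral m) auto
  also have "\<dots> = (\<integral>\<^sup>+n. \<integral>\<^sup>+x. h (of_int_vec n + x) * indicator {n} (floor_vec (of_int_vec n + x)) \<partial>lebesgue \<partial>count_space UNIV)"
    by (simp only: nn_integral_lebesgue_translation[OF m])
  also have "\<dots> = (\<integral>\<^sup>+n. \<integral>\<^sup>+x. h (of_int_vec n + x) * indicator unit_cell x \<partial>lebesgue \<partial>count_space UNIV)"
  proof (intro nn_integral_cong)
    fix n and x :: "real ^ 'n"
    show "h (of_int_vec n + x) * indicator {n} (floor_vec (of_int_vec n + x)) = h (of_int_vec n + x) * indicator unit_cell x"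
      using diff_mem_unit_cell_iff[of "of_int_vec n + x" n] by (auto simp: indicator_def)
  qed
  finally show ?thesis .
qed

text \<open>Reflecting the summation index gives the sign that occurs in the periodization.\<close>

lemma nn_integral_unit_cells_minus:
  fixes h :: "real ^ 'n \<Rightarrow> ennreal"
  assumes h: "h \<in> borel_measurable lebesgue"
  shows "(\<integral>\<^sup>+x. h x \<partial>lebesgue) =
    (\<integral>\<^sup>+n. \<integral>\<^sup>+x. h (x - of_int_vec n) * indicator unit_cell x \<partial>lebesgue \<partial>count_space UNIV)"
proof -
  have "bij_betw uminus UNIV (UNIV :: (int ^ 'n) set)"
    by (rule bij_betw_byWitness[of _ uminus]) auto
  from nn_integral_bij_count_space[OF this, of "\<lambda>n. \<integral>\<^sup>+x. h (of_int_vec n + x) * indicator unit_cell x \<partial>lebesgue"]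
  show ?thesis
    unfolding nn_integral_unit_cells[OF h] by (simp add: of_int_vec_minus add.commute)
qed

text \<open>The integrand is constant on cells of measure 1. This identifies sums of samples with
  integrals of step functions.\<close>

lemma nn_integral_floor_vec:
  fixes h :: "int ^ 'n \<Rightarrow> ennreal"
  shows "(\<integral>\<^sup>+x. h (floor_vec x) \<partial>lebesgue) = (\<integral>\<^sup>+n. h n \<partial>count_space UNIV)"
proof -
  have "(\<integral>\<^sup>+x. h (floor_vec x) \<partial>lebesgue) =
     (\<integral>\<^sup>+n. \<integral>\<^sup>+x. h n * indicator unit_cell (x :: real ^ 'n) \<partial>lebesgue \<partial>count_space UNIV)"
    by (subst nn_integral_unit_cells)
       (auto intro!: nn_integral_cong simp: indicator_def floor_vec_add_int)
  then show ?thesis by (simp add: nn_integral_cmult_indicator emeasure_unit_cell)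
qed

lemma measurable_lebesgue_diff:
  fixes f :: "'a::euclidean_space \<Rightarrow> 'b::topological_space"
  assumes "f \<in> borel_measurable lebesgue"
  shows "(\<lambda>x. f (x - t)) \<in> borel_measurable lebesgue"
  using measurable_compose[OF measurable_lebesgue_translation[of "- t"] assms] by simp

lemma infsum_UNIV_shift:
  fixes f :: "int ^ 'n \<Rightarrow> complex"
  shows "(\<Sum>\<^sub>\<infinity>k. f k) = (\<Sum>\<^sub>\<infinity>m. f (n + m))"
proof -
  have "bij_betw (\<lambda>m. n + m) UNIV (UNIV :: (int ^ 'n) set)"
    by (rule bij_betw_byWitness[of _ "\<lambda>m. m - n"]) auto
  from infsum_reindex_bij_betw[OF this, of f] show ?thesis by simp
qed

text \<open>
  On the cell \<open>n + [0,1)^d\<close> replace every sample \<open>F k\<close> by \<open>F n\<close>: what remains is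
  \<open>F n * (P \<phi> - 1)\<close>, and the error involves only differences of samples.
\<close>

lemma shift_synthesis_minus_step:
  fixes \<phi> :: "real ^ 'n \<Rightarrow> complex" and F :: "int ^ 'n \<Rightarrow> complex"
  assumes p: "0 < p" "p \<le> 1"
    and \<phi> [measurable]: "\<phi> \<in> borel_measurable lebesgue"
    and \<phi>_fin: "(\<integral>\<^sup>+x. ppow p (\<phi> x) \<partial>lebesgue) < top"
    and F_fin: "(\<integral>\<^sup>+n. ppow p (F n) \<partial>count_space UNIV) < top"
  shows "(\<integral>\<^sup>+x. ppow p ((\<Sum>\<^sub>\<infinity>k. F k * \<phi> (x - of_int_vec k)) - F (floor_vec x)) \<partial>lebesgue)
    \<le> (\<integral>\<^sup>+n. ppow p (F n) \<partial>count_space UNIV) *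
        (\<integral>\<^sup>+x. ppow p ((\<Sum>\<^sub>\<infinity>k. \<phi> (x - of_int_vec k)) - 1) * indicator unit_cell x \<partial>lebesgue)
      + (\<integral>\<^sup>+m. (\<integral>\<^sup>+x. ppow p (\<phi> (x - of_int_vec m)) * indicator unit_cell x \<partial>lebesgue) *
           (\<integral>\<^sup>+n. ppow p (F (n + m) - F n) \<partial>count_space UNIV) \<partial>count_space UNIV)"
    (is "?L \<le> ?N * ?\<theta> + ?E")
proof -
  let ?S = "\<lambda>x. \<Sum>\<^sub>\<infinity>k. F k * \<phi> (x - of_int_vec k)"
  let ?P = "\<lambda>x. \<Sum>\<^sub>\<infinity>k. \<phi> (x - of_int_vec k)"
  note [measurable] = measurable_ppow[OF p]
  have \<phi>m [measurable]: "(\<lambda>x. \<phi> (x - t)) \<in> borel_measurable lebesgue" for t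
    by (rule measurable_lebesgue_diff[OF \<phi>])
  have Sm [measurable]: "?S \<in> borel_measurable lebesgue" and Pm [measurable]: "?P \<in> borel_measurable lebesgue"
    by (auto intro!: measurable_infsum)
  \<comment> \<open>Summing over the translates unfolds the unit cell to the whole space. Hence for
    almost every point of the cell the \<open>p\<close>-th powers of \<phi> at its translates have a
    finite sum.\<close>
  have "(\<integral>\<^sup>+x. \<integral>\<^sup>+m. ppow p (\<phi> (x - of_int_vec m)) * indicator unit_cell x \<partial>count_space UNIV \<partial>lebesgue) = (\<integral>\<^sup>+x. ppow p (\<phi> x) \<partial>lebesgue)"
    by (subst nn_integral_count_space_nn_integral; (subst nn_integral_unit_cells_minus)?) auto
  then have AE: "AE x in lebesgue. (\<integral>\<^sup>+m. ppow p (\<phi> (x - of_int_vec m)) * indicator unit_cell x \<partial>count_space UNIV) \<noteq> \<infinity>"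
    using \<phi>_fin by (intro nn_integral_PInf_AE) (auto intro!: measurable_nn_integral_count_space)
  \<comment> \<open>The finiteness condition concerns the base point in the unit cell only, so one
    null set serves all cells \<open>n\<close>.\<close>
  have pt: "ppow p (?S (of_int_vec n + x) - F n) \<le>
      ppow p (F n) * ppow p (?P x - 1) + (\<integral>\<^sup>+m. ppow p (F (n + m) - F n) * ppow p (\<phi> (x - of_int_vec m)) \<partial>count_space UNIV)"
    if fin: "(\<integral>\<^sup>+m. ppow p (\<phi> (x - of_int_vec m)) \<partial>count_space UNIV) < top" for n x
  proof -
    \<comment> \<open>Each sample is bounded by the total, so multiplication by samples preserves
      the finiteness of the sums.\<close>
    have le: "ppow p (F k) \<le> ?N" for k
      by (rule nn_integral_ge_point) simp
    have s1: "(\<lambda>m. \<phi> (x - of_int_vec m)) summable_on UNIV"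
      by (rule summable_ppow[OF p fin])
    have "(\<integral>\<^sup>+m. ppow p (F (n + m) * \<phi> (x - of_int_vec m)) \<partial>count_space UNIV) \<le> (\<integral>\<^sup>+m. ?N * ppow p (\<phi> (x - of_int_vec m)) \<partial>count_space UNIV)"
      by (intro nn_integral_mono) (auto simp: ppow_mult[OF p] intro!: mult_right_mono le)
    also have "\<dots> < top" using F_fin fin by (simp add: nn_integral_cmult ennreal_mult_less_top)
    finally have s2: "(\<lambda>m. F (n + m) * \<phi> (x - of_int_vec m)) summable_on UNIV"
      by (rule summable_ppow[OF p])
    have s3: "(\<lambda>m. (F (n + m) - F n) * \<phi> (x - of_int_vec m)) summable_on UNIV"
      using summable_on_add[OF s2 summable_on_cmult_right[OF s1, of "- F n"]] by (simp add: left_diff_distrib)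
    \<comment> \<open>The substitution k = n + m removes the cell index from the argument of \<phi>
      and leaves it in the samples only.\<close>
    have "?S (of_int_vec n + x) = (\<Sum>\<^sub>\<infinity>m. F (n + m) * \<phi> (x - of_int_vec m))"
      by (subst infsum_UNIV_shift[of _ n]) (simp add: of_int_vec_add)
    also have "\<dots> = (\<Sum>\<^sub>\<infinity>m. F n * \<phi> (x - of_int_vec m) + (F (n + m) - F n) * \<phi> (x - of_int_vec m))"
      by (simp add: algebra_simps)
    also have "\<dots> = F n * ?P x + (\<Sum>\<^sub>\<infinity>m. (F (n + m) - F n) * \<phi> (x - of_int_vec m))"
      using infsum_add[OF summable_on_cmult_right[OF s1, of "F n"] s3] infsum_cmult_right[of "F n" "\<lambda>m. \<phi> (x - of_int_vec m)" UNIV] s1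
      by simp
    finally have "?S (of_int_vec n + x) - F n = F n * (?P x - 1) + (\<Sum>\<^sub>\<infinity>m. (F (n + m) - F n) * \<phi> (x - of_int_vec m))"
      by (simp add: algebra_simps)
    then have "ppow p (?S (of_int_vec n + x) - F n) \<le> ppow p (F n * (?P x - 1)) + ppow p (\<Sum>\<^sub>\<infinity>m. (F (n + m) - F n) * \<phi> (x - of_int_vec m))"
      using ppow_add_le[OF p] by simp
    also have "\<dots> \<le> ppow p (F n) * ppow p (?P x - 1) + (\<integral>\<^sup>+m. ppow p (F (n + m) - F n) * ppow p (\<phi> (x - of_int_vec m)) \<partial>count_space UNIV)"
      unfolding ppow_mult[OF p, symmetric] by (intro add_left_mono ppow_infsum_le p)
    finally show ?thesis .
  qed
  have "?L = (\<integral>\<^sup>+n. \<integral>\<^sup>+x. ppow p (?S (of_int_vec n + x) - F n) * indicator unit_cell x \<partial>lebesgue \<partial>count_space UNIV)"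
    by (subst nn_integral_unit_cells) (auto intro!: nn_integral_cong simp: indicator_def floor_vec_add_int)
  also have "\<dots> \<le> (\<integral>\<^sup>+n. \<integral>\<^sup>+x. (ppow p (F n) * (ppow p (?P x - 1) * indicator unit_cell x) +
      (\<integral>\<^sup>+m. ppow p (F (n + m) - F n) * (ppow p (\<phi> (x - of_int_vec m)) * indicator unit_cell x) \<partial>count_space UNIV)) \<partial>lebesgue \<partial>count_space UNIV)"
    (is "_ \<le> (\<integral>\<^sup>+n. (\<integral>\<^sup>+x. ?A n x + ?B n x \<partial>lebesgue) \<partial>_)")
    by (intro nn_integral_mono nn_integral_mono_AE) (use AE pt in \<open>auto simp: indicator_def less_top elim!: eventually_mono\<close>)
  also have "\<dots> = (\<integral>\<^sup>+n. ppow p (F n) * ?\<theta> \<partial>count_space UNIV) + (\<integral>\<^sup>+n. (\<integral>\<^sup>+x. ?B n x \<partial>lebesgue) \<partial>count_space UNIV)"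
    by (subst nn_integral_add; (subst nn_integral_add)?) 
       (auto intro!: measurable_nn_integral_count_space simp: nn_integral_cmult)
  also have "(\<integral>\<^sup>+n. ppow p (F n) * ?\<theta> \<partial>count_space UNIV) = ?N * ?\<theta>"
    by (simp add: nn_integral_multc)
  also have "(\<integral>\<^sup>+n. (\<integral>\<^sup>+x. ?B n x \<partial>lebesgue) \<partial>count_space UNIV) =
     (\<integral>\<^sup>+n. \<integral>\<^sup>+m. ppow p (F (n + m) - F n) * (\<integral>\<^sup>+x. ppow p (\<phi> (x - of_int_vec m)) * indicator unit_cell x \<partial>lebesgue) \<partial>count_space UNIV \<partial>count_space UNIV)"
    by (subst nn_integral_count_space_nn_integral) (auto simp: nn_integral_cmult)
  also have "\<dots> = ?E"
    by (subst nn_integral_count_space_nn_integral) (auto simp: nn_integral_cmult nn_integral_multc mult.commute)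
  finally show ?thesis .
qed

subsection \<open>Sampling on fine lattices\<close>

text \<open>Dominated convergence is used twice: \<open>f\<close> is truncated in space and in size,
  and the truncation is an almost everywhere limit of continuous functions, which are modified to
  have a uniform bound and a common bounded support.\<close>

lemma dense_continuous_compact_support:
  fixes f :: "'a::euclidean_space \<Rightarrow> complex"
  assumes p: "0 < p" "p \<le> 1"
    and f: "f \<in> borel_measurable lebesgue"
    and fin: "(\<integral>\<^sup>+x. ppow p (f x) \<partial>lebesgue) < top" and e: "0 < e"
  obtains g R M where "continuous_on UNIV g" "\<And>x. R \<le> norm x \<Longrightarrow> g x = 0" "\<And>x. cmod (g x) \<le> M"
    "(\<integral>\<^sup>+x. ppow p (f x - g x) \<partial>lebesgue) < e"
proof -
  note [measurable] = measurable_ppow[OF p] f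
  \<comment> \<open>Each of the two approximations may cost \<open>e'\<close>. Since
    \<open>e\<close> may be infinite, that case is split off before halving.\<close>
  obtain e' where e': "0 < e'" "e' + e' \<le> e"
  proof (cases "e = top")
    case True then show ?thesis by (intro that[of 1]) auto
  next
    case False
    then obtain c where "e = ennreal c" "c > 0" using e by (cases e) auto
    then show ?thesis by (intro that[of "ennreal (c / 2)"]) (auto simp flip: ennreal_plus)
  qed
  \<comment> \<open>At every point the truncation equals \<open>f x\<close> or 0, so the error is
    dominated by \<open>ppow p (f x)\<close>.\<close>
  define t where "t n x = (if norm x \<le> real n \<and> cmod (f x) \<le> real n then f x else 0)" for n x
  have [measurable]: "(\<lambda>x::'a. x) \<in> borel_measurable lebesgue"
    using id_borel_measurable_lebesgue by (simp add: id_def)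
  have t_meas [measurable]: "t n \<in> borel_measurable lebesgue" for n
    unfolding t_def by measurable
  have "(\<lambda>n. \<integral>\<^sup>+x. ppow p (f x - t n x) \<partial>lebesgue) \<longlonglongrightarrow> nn_integral (lebesgue :: 'a measure) (\<lambda>_. 0)"
  proof (rule nn_integral_dominated_convergence)
    show "AE x in lebesgue. ppow p (f x - t n x) \<le> ppow p (f x)" for n
      by (rule AE_I2) (auto simp: t_def ppow_0[OF p])
    show "AE x in lebesgue. (\<lambda>n. ppow p (f x - t n x)) \<longlonglongrightarrow> 0"
    proof (rule AE_I2)
      fix x
      have "eventually (\<lambda>n. norm x \<le> real n \<and> cmod (f x) \<le> real n) sequentially"
        by (intro eventually_conj eventually_sequentiallyI[of "nat \<lceil>norm x\<rceil>"] eventually_sequentiallyI[of "nat \<lceil>cmod (f x)\<rceil>"]) linarith+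
      then have "\<forall>\<^sub>F n in sequentially. ppow p (f x - t n x) = 0"
        by eventually_elim (simp add: t_def ppow_0[OF p])
      then show "(\<lambda>n. ppow p (f x - t n x)) \<longlonglongrightarrow> 0"
        by (rule tendsto_eventually)
    qed
  qed (use fin in \<open>auto\<close>)
  then have "eventually (\<lambda>n. (\<integral>\<^sup>+x. ppow p (f x - t n x) \<partial>lebesgue) < e') sequentially"
    using e' by (auto dest: order_tendstoD(2))
  then obtain N where N: "(\<integral>\<^sup>+x. ppow p (f x - t N x) \<partial>lebesgue) < e'"
    by (auto simp: eventually_sequentially)
  have "t N measurable_on UNIV" by (rule lebesgue_measurable_imp_measurable_on) auto
  then obtain Z h where Z: "negligible Z" and h: "\<And>n. continuous_on UNIV (h n)"
    and lim: "\<And>x. x \<notin> Z \<Longrightarrow> (\<lambda>n. h n x) \<longlonglongrightarrow> t N x"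
    unfolding measurable_on_def by auto
  \<comment> \<open>The margin of 1 leaves room for the cutoff \<eta>, which is 1 on the ball of
    radius \<open>N\<close> and 0 outside the ball of radius \<open>M\<close>.\<close>
  define M where "M = real N + 1"
  define \<eta> where "\<eta> x = max 0 (min 1 (M - norm x))" for x :: 'a
  \<comment> \<open>The division clips the modulus to at most \<open>M\<close> and keeps continuity,
    as the denominator is at least 1. Clipping and cutoff both fix \<open>t N x\<close>, which has
    modulus at most \<open>N\<close> and vanishes for norm above \<open>N\<close>, so the limit is
    unchanged.\<close>
  define k where "k n x = h n x / of_real (max 1 (cmod (h n x) / M)) * of_real (\<eta> x)" for n x
  have M: "M \<ge> 1" by (simp add: M_def)
  have k_cont: "continuous_on UNIV (k n)" for n
    unfolding k_def \<eta>_def by (intro continuous_intros h) (use M in auto)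
  have k_supp: "k n x = 0" if "M \<le> norm x" for n x
    using that by (simp add: k_def \<eta>_def)
  have k_bd: "cmod (k n x) \<le> M" for n x
  proof -
    have "cmod (h n x) \<le> M * max 1 (cmod (h n x) / M)"
      using M by (auto simp: max_def field_simps)
    then have "cmod (h n x) / max 1 (cmod (h n x) / M) \<le> M"
      by (simp add: divide_le_eq)
    moreover have "0 \<le> \<eta> x" "\<eta> x \<le> 1" by (auto simp: \<eta>_def)
    ultimately have "cmod (h n x) / max 1 (cmod (h n x) / M) * \<eta> x \<le> M * 1"
      using M by (intro mult_mono) auto
    then show ?thesis using \<open>0 \<le> \<eta> x\<close> by (simp add: k_def norm_mult norm_divide)
  qed
  have k_meas [measurable]: "k n \<in> borel_measurable lebesgue" for n
    using borel_measurable_continuous_onI[OF k_cont[of n]] by (auto intro: measurable_completion)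
  have k_lim: "(\<lambda>n. k n x) \<longlonglongrightarrow> t N x" if "x \<notin> Z" for x
  proof -
    have "cmod (t N x) / M \<le> 1" using M by (auto simp: t_def M_def divide_le_eq)
    then have "t N x / of_real (max 1 (cmod (t N x) / M)) * of_real (\<eta> x) = t N x"
      by (auto simp: t_def \<eta>_def M_def max_def)
    then show ?thesis
      using M unfolding k_def by (auto intro!: tendsto_eq_intros lim[OF that])
  qed
  have [measurable]: "cball 0 M \<in> sets (lebesgue :: 'a measure)" by simp
  have pk_lim: "(\<lambda>n. ppow p (t N x - k n x)) \<longlonglongrightarrow> 0" if "x \<notin> Z" for x
    using tendsto_diff[OF tendsto_const k_lim[OF that], of "t N x"] by (intro tendsto_ppow_0[OF p]) simp
  have "(\<lambda>n. \<integral>\<^sup>+x. ppow p (t N x - k n x) \<partial>lebesgue) \<longlonglongrightarrow> nn_integral (lebesgue :: 'a measure) (\<lambda>_. 0)"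
  proof (rule nn_integral_dominated_convergence)
    show "AE x in lebesgue. ppow p (t N x - k n x) \<le> ppow p (of_real (2 * M)) * indicator (cball 0 M) x" for n
    proof (rule AE_I2)
      fix x
      show "ppow p (t N x - k n x) \<le> ppow p (of_real (2 * M)) * indicator (cball 0 M) x"
      proof (cases "norm x \<le> M")
        case True
        have "cmod (t N x) \<le> M" using M by (auto simp: t_def M_def)
        then have "cmod (t N x - k n x) \<le> cmod (of_real (2 * M))"
          using norm_triangle_ineq4[of "t N x" "k n x"] k_bd[of n x] M by simp
        with True show ?thesis by (simp add: indicator_def ppow_mono[OF p])
      next
        case False then show ?thesis by (simp add: k_supp t_def M_def ppow_0[OF p])
      qed
    qed
    show "(\<integral>\<^sup>+x. ppow p (of_real (2 * M)) * indicator (cball (0::'a) M) x \<partial>lebesgue) < \<infinity>"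
      using ppow_less_top[OF p] emeasure_lborel_cball_finite[of "0::'a" M]
      by (subst nn_integral_cmult_indicator) (auto simp: ennreal_mult_less_top less_top)
    show "AE x in lebesgue. (\<lambda>n. ppow p (t N x - k n x)) \<longlonglongrightarrow> 0"
    proof (rule AE_I')
      show "Z \<in> null_sets lebesgue" using Z by (simp add: negligible_iff_null_sets)
      show "{x \<in> space lebesgue. \<not> (\<lambda>n. ppow p (t N x - k n x)) \<longlonglongrightarrow> 0} \<subseteq> Z"
        using pk_lim by auto
    qed
  qed (simp_all, measurable?)
  then have "eventually (\<lambda>n. (\<integral>\<^sup>+x. ppow p (t N x - k n x) \<partial>lebesgue) < e') sequentially"
    using e' by (auto dest: order_tendstoD(2))
  then obtain n where n: "(\<integral>\<^sup>+x. ppow p (t N x - k n x) \<partial>lebesgue) < e'"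
    by (auto simp: eventually_sequentially)
  have "(\<integral>\<^sup>+x. ppow p (f x - k n x) \<partial>lebesgue) \<le> (\<integral>\<^sup>+x. ppow p (f x - t N x) + ppow p (t N x - k n x) \<partial>lebesgue)"
    by (intro nn_integral_mono order_trans[OF eq_refl ppow_add_le[OF p]]) simp
  also have "\<dots> = (\<integral>\<^sup>+x. ppow p (f x - t N x) \<partial>lebesgue) + (\<integral>\<^sup>+x. ppow p (t N x - k n x) \<partial>lebesgue)"
    by (rule nn_integral_add) auto
  also have "\<dots> < e' + e'" using N n by (rule add_strict_mono)
  also have "\<dots> \<le> e" by (rule e')
  finally show ?thesis using that[OF k_cont k_supp k_bd] by blast
qed

text \<open>This is the step function that on each cell T(n + [0,1)^d) takes the value of
  \<open>g\<close> at T(n + m). The offset \<open>m\<close> is a parameter so that differences of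
  samples at index distance \<open>m\<close> become differences of two such functions.\<close>

definition cell_sample :: "real ^ 'n ^ 'n \<Rightarrow> (real ^ 'n \<Rightarrow> 'b) \<Rightarrow> int ^ 'n \<Rightarrow> real ^ 'n \<Rightarrow> 'b" where
  "cell_sample T g m x = g (T *v of_int_vec (floor_vec (matrix_inv T *v x) + m))"

lemma measurable_cell_sample:
  assumes "invertible T"
  shows "cell_sample T g m \<in> borel_measurable lebesgue"
proof -
  have "floor_vec \<circ> (\<lambda>x. matrix_inv T *v x) \<in> lebesgue \<rightarrow>\<^sub>M count_space UNIV"
    by (rule measurable_completion) (simp add: measurable_comp[OF borel_mat_mult measurable_floor_vec])
  from measurable_compose[OF this, of "\<lambda>n. g (T *v of_int_vec (n + m))" borel]
  show ?thesis by (simp add: cell_sample_def[abs_def])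
qed

lemma norm_unit_cell_le: "x \<in> unit_cell \<Longrightarrow> norm x \<le> real CARD('n)" for x :: "real ^ 'n"
  using norm_le_l1_cart[of x] sum_bounded_above[of UNIV "\<lambda>i. \<bar>x $ i\<bar>" 1]
  by (force simp: unit_cell_def less_imp_le)

text \<open>The displacement is \<open>T\<close> applied to \<open>m\<close> minus the fractional
  part of the lattice coordinates of \<open>x\<close>, and that part lies in the unit cell. The
  absolute value occurs because the sign of \<open>r\<close> is not prescribed.\<close>

lemma dist_cell_sample_point:
  fixes T :: "real ^ 'n ^ 'n"
  assumes T: "invertible T" and r: "\<And>y. norm (T *v y) \<le> r * norm y"
  shows "norm (T *v of_int_vec (floor_vec (matrix_inv T *v x) + m) - x) \<le> \<bar>r\<bar> * (norm (of_int_vec m :: real ^ 'n) + real CARD('n))"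
proof -
  define s where "s = matrix_inv T *v x"
  have u: "s - of_int_vec (floor_vec s) \<in> unit_cell" by (simp add: diff_mem_unit_cell_iff)
  have "T *v of_int_vec (floor_vec s + m) - x = T *v (of_int_vec m - (s - of_int_vec (floor_vec s)))"
    by (simp add: of_int_vec_add s_def matrix_vector_mult_diff_distrib matrix_vector_right_distrib matrix_inv_cancel[OF T])
  then have "norm (T *v of_int_vec (floor_vec s + m) - x) \<le> r * norm (of_int_vec m - (s - of_int_vec (floor_vec s)))"
    using r by simp
  also have "\<dots> \<le> \<bar>r\<bar> * (norm (of_int_vec m :: real ^ 'n) + real CARD('n))"
    using norm_triangle_ineq4[of "of_int_vec m" "s - of_int_vec (floor_vec s)"] norm_unit_cell_le[OF u]
    by (intro mult_mono) auto
  finally show ?thesis by (simp add: s_def)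
qed

text \<open>In the application \<open>T j\<close> is \<open>matrix_inv (a (Suc j)) ** b\<close>,
  \<open>r j\<close> bounds its operator norm, and \<open>g\<close> is the continuous approximation
  of the given function.\<close>

locale cell_sampling =
  fixes p :: real and T :: "nat \<Rightarrow> real ^ 'n ^ 'n" and r :: "nat \<Rightarrow> real"
    and g :: "real ^ 'n \<Rightarrow> complex" and R M :: real
  assumes p: "0 < p" "p \<le> 1"
    and T: "\<And>j. invertible (T j)"
    and T_le: "\<And>j y. norm (T j *v y) \<le> r j * norm y"
    and r: "r \<longlonglongrightarrow> 0"
    and g_cont: "continuous_on UNIV g"
    and g_supp: "\<And>x. R \<le> norm x \<Longrightarrow> g x = 0"
    and g_le: "\<And>x. cmod (g x) \<le> M"
begin

lemma measurable_g: "g \<in> borel_measurable lebesgue"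
  using borel_measurable_continuous_onI[OF g_cont] by (auto intro: measurable_completion)

text \<open>The sampling point stays within \<open>B * L\<close> of \<open>x\<close> for all
  \<open>j\<close>, so one multiple of the indicator of a ball dominates all samples. Pointwise
  convergence is the continuity of \<open>g\<close>.\<close>

lemma cell_sample_dominated:
  obtains K where "K < top" "\<And>j. (\<integral>\<^sup>+x. ppow p (cell_sample (T j) g m x) \<partial>lebesgue) \<le> K"
    "(\<lambda>j. \<integral>\<^sup>+x. ppow p (cell_sample (T j) g m x - g x) \<partial>lebesgue) \<longlonglongrightarrow> 0"
proof -
  note [measurable] = measurable_ppow[OF p] measurable_cell_sample[OF T] measurable_g
  define L where "L = norm (of_int_vec m :: real ^ 'n) + real CARD('n)"
  have L: "L \<ge> 0" by (simp add: L_def)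
  from r have "Bseq r" by (rule convergent_imp_Bseq[OF convergentI])
  then obtain B where B: "B > 0" "\<And>j. \<bar>r j\<bar> \<le> B" by (auto simp: Bseq_def)
  let ?y = "\<lambda>j x. T j *v of_int_vec (floor_vec (matrix_inv (T j) *v x) + m)"
  have dist: "norm (?y j x - x) \<le> \<bar>r j\<bar> * L" for j x
    unfolding L_def by (rule dist_cell_sample_point[OF T T_le])
  have dist': "norm (?y j x - x) \<le> B * L" for j x
    using dist[of j x] mult_right_mono[OF B(2)[of j] L] by linarith
  have M0: "0 \<le> M" using g_le[of 0] norm_ge_zero by (rule order_trans[rotated])
  \<comment> \<open>The height 2M also covers differences of a sample and \<open>g\<close>; the
    radius is that of the support of \<open>g\<close>, enlarged by the largest displacement.\<close>
  define w where "w x = ppow p (of_real (2 * M)) * indicator (cball 0 (R + B * L)) x" for x :: "real ^ 'n"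
  have [measurable]: "cball 0 (R + B * L) \<in> sets (lebesgue :: (real ^ 'n) measure)" by simp
  have w_meas [measurable]: "w \<in> borel_measurable lebesgue"
    unfolding w_def[abs_def] by measurable
  have w_fin: "(\<integral>\<^sup>+x. w x \<partial>lebesgue) < top"
    unfolding w_def using ppow_less_top[OF p] emeasure_lborel_cball_finite[of "0::real ^ 'n" "R + B * L"]
    by (subst nn_integral_cmult_indicator) (auto simp: ennreal_mult_less_top less_top)
  have supp: "cell_sample (T j) g m x = 0 \<and> g x = 0" if "x \<notin> cball 0 (R + B * L)" for j x
  proof -
    have "R + B * L < norm x" using that by simp
    moreover have "0 \<le> B * L" using B(1) L by simp
    moreover have "norm x \<le> norm (?y j x) + norm (?y j x - x)"
      using norm_triangle_ineq4[of "?y j x" "?y j x - x"] by simp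
    ultimately show ?thesis using dist'[of j x] by (auto simp: cell_sample_def intro!: g_supp)
  qed
  have bd1: "ppow p (cell_sample (T j) g m x) \<le> w x" for j x
  proof (cases "x \<in> cball 0 (R + B * L)")
    case True then show ?thesis
      using g_le[of "?y j x"] M0 by (auto simp: w_def cell_sample_def intro!: ppow_mono[OF p])
  qed (use supp[of x j] in \<open>auto simp: ppow_0[OF p]\<close>)
  have bd2: "ppow p (cell_sample (T j) g m x - g x) \<le> w x" for j x
  proof (cases "x \<in> cball 0 (R + B * L)")
    case True
    have "cmod (cell_sample (T j) g m x - g x) \<le> 2 * M"
      using norm_triangle_ineq4[of "cell_sample (T j) g m x" "g x"] g_le[of "?y j x"] g_le[of x]
      by (simp add: cell_sample_def)
    with True M0 show ?thesis by (auto simp: w_def intro!: ppow_mono[OF p])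
  qed (use supp[of x j] in \<open>auto simp: ppow_0[OF p]\<close>)
  have lim: "(\<lambda>j. ppow p (cell_sample (T j) g m x - g x)) \<longlonglongrightarrow> 0" for x
  proof -
    have "(\<lambda>j. \<bar>r j\<bar> * L) \<longlonglongrightarrow> 0"
      using r by (auto intro!: tendsto_eq_intros)
    then have "(\<lambda>j. ?y j x - x) \<longlonglongrightarrow> 0"
      by (rule Lim_null_comparison[rotated]) (use dist in auto)
    then have "(\<lambda>j. ?y j x) \<longlonglongrightarrow> x" by (simp add: LIM_zero_iff)
    then have "(\<lambda>j. cell_sample (T j) g m x) \<longlonglongrightarrow> g x"
      unfolding cell_sample_def using g_cont
      by (intro isCont_tendsto_compose[of x g]) (auto simp: continuous_on_eq_continuous_at)
    then show ?thesis by (intro tendsto_ppow_0[OF p]) (simp add: LIM_zero_iff)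
  qed
  have "(\<lambda>j. \<integral>\<^sup>+x. ppow p (cell_sample (T j) g m x - g x) \<partial>lebesgue) \<longlonglongrightarrow> nn_integral (lebesgue :: (real ^ 'n) measure) (\<lambda>_. 0)"
    by (rule nn_integral_dominated_convergence[where w = w]) (use w_fin bd2 lim in auto)
  then show ?thesis
    by (intro that[OF w_fin nn_integral_mono]) (use bd1 in auto)
qed

end

text \<open>In the coordinates x = T u the step functions depend on \<open>floor_vec u\<close> only,
  so the integrals become lattice sums times the cell volume |det T|.\<close>

lemma nn_integral_cell_sample:
  fixes T :: "real ^ 'n ^ 'n" and g :: "real ^ 'n \<Rightarrow> complex"
  assumes p: "0 < p" "p \<le> 1" and T: "invertible T"
  shows "(\<integral>\<^sup>+x. ppow p (cell_sample T g m x) \<partial>lebesgue) =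
      ennreal \<bar>det T\<bar> * (\<integral>\<^sup>+n. ppow p (g (T *v of_int_vec (n + m))) \<partial>count_space UNIV)"
    and "(\<integral>\<^sup>+x. ppow p (cell_sample T g m x - cell_sample T g m' x) \<partial>lebesgue) =
      ennreal \<bar>det T\<bar> * (\<integral>\<^sup>+n. ppow p (g (T *v of_int_vec (n + m)) - g (T *v of_int_vec (n + m'))) \<partial>count_space UNIV)"
proof -
  note [measurable] = measurable_ppow[OF p] measurable_cell_sample[OF T]
  have "(\<integral>\<^sup>+x. ppow p (cell_sample T g m x) \<partial>lebesgue) =
      ennreal \<bar>det T\<bar> * (\<integral>\<^sup>+x. ppow p (cell_sample T g m (T *v x)) \<partial>lebesgue)"
    by (rule nn_integral_lebesgue_linear[OF T]) measurable
  then show "(\<integral>\<^sup>+x. ppow p (cell_sample T g m x) \<partial>lebesgue) =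
      ennreal \<bar>det T\<bar> * (\<integral>\<^sup>+n. ppow p (g (T *v of_int_vec (n + m))) \<partial>count_space UNIV)"
    using nn_integral_floor_vec[of "\<lambda>n. ppow p (g (T *v of_int_vec (n + m)))"]
    by (simp add: cell_sample_def matrix_inv_cancel[OF T])
  have "(\<integral>\<^sup>+x. ppow p (cell_sample T g m x - cell_sample T g m' x) \<partial>lebesgue) =
      ennreal \<bar>det T\<bar> * (\<integral>\<^sup>+x. ppow p (cell_sample T g m (T *v x) - cell_sample T g m' (T *v x)) \<partial>lebesgue)"
    by (rule nn_integral_lebesgue_linear[OF T]) measurable
  then show "(\<integral>\<^sup>+x. ppow p (cell_sample T g m x - cell_sample T g m' x) \<partial>lebesgue) =
      ennreal \<bar>det T\<bar> * (\<integral>\<^sup>+n. ppow p (g (T *v of_int_vec (n + m)) - g (T *v of_int_vec (n + m'))) \<partial>count_space UNIV)"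
    using nn_integral_floor_vec[of "\<lambda>n. ppow p (g (T *v of_int_vec (n + m)) - g (T *v of_int_vec (n + m')))"]
    by (simp add: cell_sample_def matrix_inv_cancel[OF T])
qed

lemma nn_integral_count_space_shift:
  fixes h :: "int ^ 'n \<Rightarrow> ennreal"
  shows "(\<integral>\<^sup>+n. h (n + m) \<partial>count_space UNIV) = (\<integral>\<^sup>+n. h n \<partial>count_space UNIV)"
  by (rule nn_integral_bij_count_space, rule bij_betw_byWitness[of _ "\<lambda>n. n - m"]) auto

context cell_sampling
begin

text \<open>Dominated convergence over the offsets \<open>m\<close>: for fixed \<open>m\<close> both
  step functions converge to \<open>g\<close>, and a bound uniform in \<open>m\<close> exists
  because a lattice sum is invariant under shifts of the lattice.\<close>

lemma translation_error_tendsto_0: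
  fixes w :: "int ^ 'n \<Rightarrow> ennreal"
  assumes w: "(\<integral>\<^sup>+m. w m \<partial>count_space UNIV) < top"
  shows "(\<lambda>j. \<integral>\<^sup>+m. w m * (\<integral>\<^sup>+x. ppow p (cell_sample (T j) g m x - cell_sample (T j) g 0 x) \<partial>lebesgue)
            \<partial>count_space UNIV) \<longlonglongrightarrow> 0"
proof -
  note [measurable] = measurable_ppow[OF p] measurable_cell_sample[OF T] measurable_g
  let ?D = "\<lambda>j m. \<integral>\<^sup>+x. ppow p (cell_sample (T j) g m x - cell_sample (T j) g 0 x) \<partial>lebesgue"
  let ?G = "\<lambda>j m. \<integral>\<^sup>+x. ppow p (cell_sample (T j) g m x - g x) \<partial>lebesgue"
  have G: "(\<lambda>j. ?G j m) \<longlonglongrightarrow> 0" for m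
    by (rule cell_sample_dominated[of m]) blast
  \<comment> \<open>The bound supplied here may depend on the offset; it is taken at offset 0 and
    carried to all others by \<open>eq\<close>.\<close>
  obtain K where K: "K < top" "\<And>j. (\<integral>\<^sup>+x. ppow p (cell_sample (T j) g 0 x) \<partial>lebesgue) \<le> K"
    by (rule cell_sample_dominated[of 0]) blast
  have eq: "(\<integral>\<^sup>+x. ppow p (cell_sample (T j) g m x) \<partial>lebesgue) = (\<integral>\<^sup>+x. ppow p (cell_sample (T j) g 0 x) \<partial>lebesgue)" for j m
    unfolding nn_integral_cell_sample[OF p T]
    using nn_integral_count_space_shift[of "\<lambda>n. ppow p (g (T j *v of_int_vec n))" m] by simp
  have K': "(\<integral>\<^sup>+x. ppow p (cell_sample (T j) g m x) \<partial>lebesgue) \<le> K" for j m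
    using K(2)[of j] eq[of j m] by simp
  have D_K: "?D j m \<le> K + K" for j m
  proof -
    have "?D j m \<le> (\<integral>\<^sup>+x. ppow p (cell_sample (T j) g m x) + ppow p (cell_sample (T j) g 0 x) \<partial>lebesgue)"
      by (intro nn_integral_mono ppow_diff_le p)
    also have "\<dots> = (\<integral>\<^sup>+x. ppow p (cell_sample (T j) g m x) \<partial>lebesgue) + (\<integral>\<^sup>+x. ppow p (cell_sample (T j) g 0 x) \<partial>lebesgue)"
      by (rule nn_integral_add) auto
    finally show ?thesis using add_mono[OF K'[of j m] K'[of j 0]] by order
  qed
  have D_G: "?D j m \<le> ?G j m + ?G j 0" for j m
  proof -
    have "?D j m \<le> (\<integral>\<^sup>+x. ppow p (cell_sample (T j) g m x - g x) + ppow p (cell_sample (T j) g 0 x - g x) \<partial>lebesgue)"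
      by (intro nn_integral_mono order_trans[OF eq_refl ppow_diff_le[OF p]]) simp
    also have "\<dots> = ?G j m + ?G j 0" by (rule nn_integral_add) auto
    finally show ?thesis .
  qed
  have D_lim: "(\<lambda>j. ?D j m) \<longlonglongrightarrow> 0" for m
  proof (rule tendsto_sandwich[OF _ _ tendsto_const])
    show "(\<lambda>j. ?G j m + ?G j 0) \<longlonglongrightarrow> 0" using tendsto_add[OF G[of m] G[of 0]] by simp
  qed (use D_G in auto)
  have "(\<lambda>j. \<integral>\<^sup>+m. w m * ?D j m \<partial>count_space UNIV) \<longlonglongrightarrow> nn_integral (count_space (UNIV :: (int ^ 'n) set)) (\<lambda>_. 0)"
  proof (rule nn_integral_dominated_convergence[where w = "\<lambda>m. w m * (K + K)"])
    show "AE m in count_space UNIV. w m * ?D j m \<le> w m * (K + K)" for j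
      by (intro AE_I2 mult_left_mono D_K) auto
    show "(\<integral>\<^sup>+m. w m * (K + K) \<partial>count_space UNIV) < \<infinity>"
      using w K by (simp add: nn_integral_multc ennreal_mult_less_top)
    show "AE m in count_space UNIV. (\<lambda>j. w m * ?D j m) \<longlonglongrightarrow> 0"
    proof (rule AE_I2)
      fix m
      have "w m \<le> (\<integral>\<^sup>+m. w m \<partial>count_space UNIV)" by (rule nn_integral_ge_point) simp
      then have "w m < top" using w by order
      then show "(\<lambda>j. w m * ?D j m) \<longlonglongrightarrow> 0"
        using ennreal_tendsto_cmult[OF _ D_lim[of m], of "w m"] by simp
    qed
  qed auto
  then show ?thesis by simp
qed

text \<open>The estimate \<open>shift_synthesis_minus_step\<close> is applied to the samples of
  \<open>g\<close> in the lattice coordinates. The \<open>e\<close> next to the integral of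
  \<open>g\<close> bounds the excess of the step function over \<open>g\<close>; the last two bound
  the translation error and the distance from the step function to \<open>g\<close>.\<close>

lemma single_scale_approximation:
  fixes \<phi> :: "real ^ 'n \<Rightarrow> complex"
  assumes \<phi>: "\<phi> \<in> borel_measurable lebesgue"
    and \<phi>_fin: "(\<integral>\<^sup>+x. ppow p (\<phi> x) \<partial>lebesgue) < top"
    and \<theta>: "\<theta> = (\<integral>\<^sup>+x. ppow p ((\<Sum>\<^sub>\<infinity>k. \<phi> (x - of_int_vec k)) - 1) * indicator unit_cell x \<partial>lebesgue)"
    and e: "0 < e"
  shows "\<forall>\<^sub>F j in sequentially.
    ennreal \<bar>det (T j)\<bar> * (\<integral>\<^sup>+n. ppow p (g (T j *v of_int_vec n)) \<partial>count_space UNIV)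
      \<le> (\<integral>\<^sup>+x. ppow p (g x) \<partial>lebesgue) + e \<and>
    (\<integral>\<^sup>+x. ppow p (g x - (\<Sum>\<^sub>\<infinity>k. g (T j *v of_int_vec k) * \<phi> (matrix_inv (T j) *v x - of_int_vec k))) \<partial>lebesgue)
      \<le> ((\<integral>\<^sup>+x. ppow p (g x) \<partial>lebesgue) + e) * \<theta> + e + e"
proof -
  note [measurable] = measurable_ppow[OF p] measurable_cell_sample[OF T] measurable_g \<phi>
  define w where "w m = (\<integral>\<^sup>+x. ppow p (\<phi> (x - of_int_vec m)) * indicator unit_cell x \<partial>lebesgue)" for m
  let ?D = "\<lambda>j m. \<integral>\<^sup>+x. ppow p (cell_sample (T j) g m x - cell_sample (T j) g 0 x) \<partial>lebesgue"
  let ?N = "\<lambda>j. \<integral>\<^sup>+x. ppow p (cell_sample (T j) g 0 x) \<partial>lebesgue"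
  let ?G = "\<lambda>j. \<integral>\<^sup>+x. ppow p (cell_sample (T j) g 0 x - g x) \<partial>lebesgue"
  let ?F = "\<lambda>j n. g (T j *v of_int_vec n)"
  let ?S = "\<lambda>j u. \<Sum>\<^sub>\<infinity>k. ?F j k * \<phi> (u - of_int_vec k)"
  have "(\<integral>\<^sup>+m. w m \<partial>count_space UNIV) < top"
    using \<phi>_fin unfolding w_def by (subst (asm) nn_integral_unit_cells_minus) auto
  from translation_error_tendsto_0[OF this]
  have ev1: "\<forall>\<^sub>F j in sequentially. (\<integral>\<^sup>+m. w m * ?D j m \<partial>count_space UNIV) < e"
    using e by (rule order_tendstoD(2))
  have "?G \<longlonglongrightarrow> 0" by (rule cell_sample_dominated[of 0]) blast
  then have ev2: "\<forall>\<^sub>F j in sequentially. ?G j < e"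
    using e by (rule order_tendstoD(2))
  obtain K where K: "K < top" "\<And>j. ?N j \<le> K"
    by (rule cell_sample_dominated[of 0]) blast
  show ?thesis
    using ev1 ev2
  proof eventually_elim
    case (elim j)
    have d: "det (T j) \<noteq> 0" using T by (simp add: invertible_det_nz)
    have N_eq: "?N j = ennreal \<bar>det (T j)\<bar> * (\<integral>\<^sup>+n. ppow p (?F j n) \<partial>count_space UNIV)"
      using nn_integral_cell_sample(1)[OF p T, where m = 0] by simp
    have D_eq: "?D j m = ennreal \<bar>det (T j)\<bar> * (\<integral>\<^sup>+n. ppow p (?F j (n + m) - ?F j n) \<partial>count_space UNIV)" for m
      using nn_integral_cell_sample(2)[OF p T, where m = m and m' = 0] by simp
    \<comment> \<open>The cells have positive volume, so the finite integral of the step function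
      forces a finite sum of samples.\<close>
    have F_fin: "(\<integral>\<^sup>+n. ppow p (?F j n) \<partial>count_space UNIV) < top"
      using order.strict_trans1[OF K(2)[of j] K(1)] d unfolding N_eq by (auto simp: ennreal_mult_less_top)
    have "?N j \<le> (\<integral>\<^sup>+x. ppow p (g x) + ppow p (cell_sample (T j) g 0 x - g x) \<partial>lebesgue)"
      by (intro nn_integral_mono order_trans[OF eq_refl ppow_add_le[OF p]]) simp
    also have "\<dots> = (\<integral>\<^sup>+x. ppow p (g x) \<partial>lebesgue) + ?G j"
      by (rule nn_integral_add) auto
    also have "\<dots> \<le> (\<integral>\<^sup>+x. ppow p (g x) \<partial>lebesgue) + e"
      using elim by (intro add_left_mono) auto
    finally have N_le: "?N j \<le> (\<integral>\<^sup>+x. ppow p (g x) \<partial>lebesgue) + e" .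
    have [measurable]: "(\<lambda>x. \<phi> (x - t)) \<in> borel_measurable lebesgue" for t
      by (rule measurable_lebesgue_diff[OF \<phi>])
    have [measurable]: "?S j \<in> borel_measurable lebesgue"
      by (auto intro!: measurable_infsum)
    have [measurable]: "(\<lambda>x. ?S j (matrix_inv (T j) *v x)) \<in> borel_measurable lebesgue"
      by (rule measurable_compose[OF measurable_lebesgue_linear[OF invertible_matrix_inv[OF T]]]) simp
    have "(\<integral>\<^sup>+x. ppow p (?S j (matrix_inv (T j) *v x) - cell_sample (T j) g 0 x) \<partial>lebesgue)
      = ennreal \<bar>det (T j)\<bar> * (\<integral>\<^sup>+x. ppow p (?S j (matrix_inv (T j) *v (T j *v x)) - cell_sample (T j) g 0 (T j *v x)) \<partial>lebesgue)"
      by (rule nn_integral_lebesgue_linear[OF T]) measurable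
    also have "\<dots> = ennreal \<bar>det (T j)\<bar> * (\<integral>\<^sup>+u. ppow p (?S j u - ?F j (floor_vec u)) \<partial>lebesgue)"
      by (simp add: cell_sample_def matrix_inv_cancel[OF T])
    also have "\<dots> \<le> ennreal \<bar>det (T j)\<bar> * ((\<integral>\<^sup>+n. ppow p (?F j n) \<partial>count_space UNIV) * \<theta> +
        (\<integral>\<^sup>+m. w m * (\<integral>\<^sup>+n. ppow p (?F j (n + m) - ?F j n) \<partial>count_space UNIV) \<partial>count_space UNIV))"
      unfolding w_def \<theta> by (intro mult_left_mono shift_synthesis_minus_step[OF p \<phi> \<phi>_fin F_fin]) auto
    \<comment> \<open>The Jacobian is distributed over both terms and turns the lattice sums back
      into integrals of step functions.\<close>
    also have "\<dots> = ?N j * \<theta> + (\<integral>\<^sup>+m. w m * ?D j m \<partial>count_space UNIV)"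
      unfolding N_eq D_eq
      by (simp add: distrib_left mult.assoc mult.left_commute[of "w _"] nn_integral_cmult)
    also have "\<dots> \<le> ((\<integral>\<^sup>+x. ppow p (g x) \<partial>lebesgue) + e) * \<theta> + e"
      using elim N_le by (intro add_mono mult_right_mono) auto
    finally have 1: "(\<integral>\<^sup>+x. ppow p (?S j (matrix_inv (T j) *v x) - cell_sample (T j) g 0 x) \<partial>lebesgue)
       \<le> ((\<integral>\<^sup>+x. ppow p (g x) \<partial>lebesgue) + e) * \<theta> + e" .
    have "(\<integral>\<^sup>+x. ppow p (g x - ?S j (matrix_inv (T j) *v x)) \<partial>lebesgue) \<le>
      (\<integral>\<^sup>+x. ppow p (?S j (matrix_inv (T j) *v x) - cell_sample (T j) g 0 x) + ppow p (cell_sample (T j) g 0 x - g x) \<partial>lebesgue)"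
      by (subst ppow_minus_commute[OF p], intro nn_integral_mono order_trans[OF eq_refl ppow_add_le[OF p]]) simp
    also have "\<dots> = (\<integral>\<^sup>+x. ppow p (?S j (matrix_inv (T j) *v x) - cell_sample (T j) g 0 x) \<partial>lebesgue) + ?G j"
      by (rule nn_integral_add) auto
    also have "\<dots> \<le> ((\<integral>\<^sup>+x. ppow p (g x) \<partial>lebesgue) + e) * \<theta> + e + e"
      using 1 elim by (intro add_mono) auto
    finally show ?case using N_le N_eq by simp
  qed
qed

end

subsection \<open>Affine synthesis\<close>

text \<open>For positive \<open>p\<close> this is the \<open>p\<close>-th power of
  \<open>lp_norm\<close> on \<open>lp_space\<close> and infinite elsewhere.\<close>

definition coeff_sum :: "real \<Rightarrow> (nat \<times> (int ^ 'n) \<Rightarrow> complex) \<Rightarrow> ennreal" where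
  "coeff_sum p c = (\<integral>\<^sup>+i. ppow p (c i) \<partial>count_space scale_shift_index)"

lemma countable_scale_shift_index: "countable scale_shift_index"
  by (rule countableI_type)

lemma synthesis_eq:
  "synthesis p a b \<psi> c x = (\<Sum>\<^sub>\<infinity>i\<in>scale_shift_index. c i * affine_atom p a b \<psi> (fst i) (snd i) x)"
  unfolding synthesis_def by (intro infsum_cong) auto

section \<open>Extended-valued forms of the norms\<close>

lemma nn_integral_count_space_infsum_real:
  fixes f :: "'a \<Rightarrow> real"
  assumes nonneg: "\<And>i. i \<in> A \<Longrightarrow> 0 \<le> f i"
  shows "f summable_on A \<longleftrightarrow> (\<integral>\<^sup>+i. ennreal (f i) \<partial>count_space A) < top"
    and "f summable_on A \<Longrightarrow> (\<integral>\<^sup>+i. ennreal (f i) \<partial>count_space A) = ennreal (infsum f A)"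
proof -
  have *: "f summable_on A \<longleftrightarrow> integrable (count_space A) f"
    unfolding summable_on_iff_abs_summable_on_real[of f A]
      abs_summable_equivalent Infinite_Set_Sum.abs_summable_on_def ..
  show "f summable_on A \<longleftrightarrow> (\<integral>\<^sup>+i. ennreal (f i) \<partial>count_space A) < top"
  proof -
    have "(\<integral>\<^sup>+i. ennreal (norm (f i)) \<partial>count_space A) = (\<integral>\<^sup>+i. ennreal (f i) \<partial>count_space A)"
      using nonneg by (intro nn_integral_cong) simp
    then show ?thesis unfolding * integrable_iff_bounded by simp
  qed
  show "(\<integral>\<^sup>+i. ennreal (f i) \<partial>count_space A) = ennreal (infsum f A)" if "f summable_on A"
    using that nonneg infsetsum_infsum[of f A] nn_integral_conv_infsetsum[of f A]
    by (simp add: * Infinite_Set_Sum.abs_summable_on_def)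
qed

lemma
  assumes p: "0 < p"
  shows lp_space_iff: "c \<in> lp_space p \<longleftrightarrow> coeff_sum p c < top"
    and lp_norm_eq: "c \<in> lp_space p \<Longrightarrow> lp_norm p c = enn2real (coeff_sum p c) powr (1 / p)"
  using nn_integral_count_space_infsum_real[of scale_shift_index "\<lambda>i. cmod (c i) powr p"]
  by (auto simp: lp_space_def lp_norm_def coeff_sum_def ppow_def infsum_nonneg)

lemma
  assumes p: "0 < p"
  shows Lp_space_iff: "f \<in> Lp_space M p \<longleftrightarrow> f \<in> borel_measurable M \<and> (\<integral>\<^sup>+x. ppow p (f x) \<partial>M) < top"
    and Lp_norm_eq: "f \<in> borel_measurable M \<Longrightarrow> Lp_norm M p f = enn2real (\<integral>\<^sup>+x. ppow p (f x) \<partial>M) powr (1 / p)"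
proof -
  have m: "(\<lambda>x. cmod (f x) powr p) \<in> borel_measurable M" if [measurable]: "f \<in> borel_measurable M"
    by measurable
  show "f \<in> Lp_space M p \<longleftrightarrow> f \<in> borel_measurable M \<and> (\<integral>\<^sup>+x. ppow p (f x) \<partial>M) < top"
    using m by (auto simp: Lp_space_def ppow_def integrable_iff_bounded)
  show "Lp_norm M p f = enn2real (\<integral>\<^sup>+x. ppow p (f x) \<partial>M) powr (1 / p)" if "f \<in> borel_measurable M"
    using m[OF that] by (simp add: Lp_norm_def ppow_def integral_eq_nn_integral)
qed

locale affine_system =
  fixes p :: real and a :: "nat \<Rightarrow> real ^ 'n ^ 'n" and b :: "real ^ 'n ^ 'n" and \<psi> :: "real ^ 'n \<Rightarrow> complex"
  assumes p: "0 < p" "p \<le> 1"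
    and a_inv: "\<And>j. 0 < j \<Longrightarrow> invertible (a j)"
    and \<psi>: "\<psi> \<in> borel_measurable lebesgue"
    and \<psi>_fin: "(\<integral>\<^sup>+x. ppow p (\<psi> x) \<partial>lebesgue) < top"
begin

abbreviation "I \<equiv> scale_shift_index :: (nat \<times> (int ^ 'n)) set"
abbreviation "S \<equiv> synthesis p a b \<psi>"
abbreviation "atom i \<equiv> affine_atom p a b \<psi> (fst i) (snd i)"

text \<open>The \<open>p\<close>-th power of the normalizing factor is |det (a j)|, exactly the
  Jacobian of the substitution; hence all atoms have the size of \<psi>.\<close>

lemma measurable_atom: "i \<in> I \<Longrightarrow> atom i \<in> borel_measurable lebesgue"
  and nn_integral_atom: "i \<in> I \<Longrightarrow> (\<integral>\<^sup>+x. ppow p (atom i x) \<partial>lebesgue) = (\<integral>\<^sup>+x. ppow p (\<psi> x) \<partial>lebesgue)"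
proof -
  assume "i \<in> I"
  then have inv: "invertible (a (fst i))" by (auto simp: scale_shift_index_def a_inv)
  define t where "t = b *v of_int_vec (snd i)"
  note [measurable] = measurable_ppow[OF p] \<psi>
  have [measurable]: "(\<lambda>x. \<psi> (x - t)) \<in> borel_measurable lebesgue"
    by (rule measurable_lebesgue_diff[OF \<psi>])
  have [measurable]: "(\<lambda>x. \<psi> (a (fst i) *v x - t)) \<in> borel_measurable lebesgue"
    by (rule measurable_compose[OF measurable_lebesgue_linear[OF inv]]) simp
  have at: "atom i = (\<lambda>x. of_real (\<bar>det (a (fst i))\<bar> powr (1 / p)) * \<psi> (a (fst i) *v x - t))"
    by (simp add: fun_eq_iff affine_atom_def t_def)
  show "atom i \<in> borel_measurable lebesgue" unfolding at by measurable
  have c: "ppow p (of_real (\<bar>det (a (fst i))\<bar> powr (1 / p))) = ennreal \<bar>det (a (fst i))\<bar>"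
    using p by (simp add: ppow_def powr_powr)
  have "(\<integral>\<^sup>+x. ppow p (atom i x) \<partial>lebesgue) = ennreal \<bar>det (a (fst i))\<bar> * (\<integral>\<^sup>+x. ppow p (\<psi> (a (fst i) *v x - t)) \<partial>lebesgue)"
    unfolding at by (simp add: ppow_mult[OF p] c nn_integral_cmult)
  also have "\<dots> = (\<integral>\<^sup>+x. ppow p (\<psi> (x - t)) \<partial>lebesgue)"
    by (rule nn_integral_lebesgue_linear[OF inv, symmetric]) measurable
  also have "\<dots> = (\<integral>\<^sup>+x. ppow p (\<psi> (- t + x)) \<partial>lebesgue)" by simp
  also have "\<dots> = (\<integral>\<^sup>+x. ppow p (\<psi> x) \<partial>lebesgue)"
    by (rule nn_integral_lebesgue_translation) measurable
  finally show "(\<integral>\<^sup>+x. ppow p (atom i x) \<partial>lebesgue) = (\<integral>\<^sup>+x. ppow p (\<psi> x) \<partial>lebesgue)" .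
qed

lemma measurable_synthesis: "S c \<in> borel_measurable lebesgue"
proof -
  have "(\<lambda>x. \<Sum>\<^sub>\<infinity>i\<in>I. c i * atom i x) \<in> borel_measurable lebesgue"
    by (intro measurable_infsum countable_scale_shift_index borel_measurable_times borel_measurable_const measurable_atom)
  then show ?thesis by (simp add: synthesis_eq[abs_def])
qed

lemma measurable_coeff_atom: "i \<in> I \<Longrightarrow> (\<lambda>x. ppow p (c i * atom i x)) \<in> borel_measurable lebesgue"
  by (intro measurable_compose[OF _ measurable_ppow[OF p]] borel_measurable_times borel_measurable_const measurable_atom)

lemma nn_integral_coeff_atoms:
  "(\<integral>\<^sup>+x. \<integral>\<^sup>+i. ppow p (c i * atom i x) \<partial>count_space I \<partial>lebesgue) = coeff_sum p c * (\<integral>\<^sup>+x. ppow p (\<psi> x) \<partial>lebesgue)"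
proof -
  note [measurable] = measurable_ppow[OF p] measurable_atom
  have "(\<integral>\<^sup>+x. \<integral>\<^sup>+i. ppow p (c i * atom i x) \<partial>count_space I \<partial>lebesgue) =
     (\<integral>\<^sup>+i. \<integral>\<^sup>+x. ppow p (c i * atom i x) \<partial>lebesgue \<partial>count_space I)"
    by (intro nn_integral_count_space_nn_integral countable_scale_shift_index measurable_coeff_atom)
  also have "\<dots> = (\<integral>\<^sup>+i. ppow p (c i) * (\<integral>\<^sup>+x. ppow p (\<psi> x) \<partial>lebesgue) \<partial>count_space I)"
    by (intro nn_integral_cong) (simp add: ppow_mult[OF p] nn_integral_cmult nn_integral_atom)
  finally show ?thesis by (simp add: coeff_sum_def nn_integral_multc)
qed

text \<open>Pointwise subadditivity and Tonelli, with all atoms of equal size. This is the source of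
  the lower constant \<open>C1\<close>.\<close>

lemma nn_integral_synthesis_le:
  "(\<integral>\<^sup>+x. ppow p (S c x) \<partial>lebesgue) \<le> coeff_sum p c * (\<integral>\<^sup>+x. ppow p (\<psi> x) \<partial>lebesgue)"
  unfolding nn_integral_coeff_atoms[symmetric] synthesis_eq
  by (intro nn_integral_mono ppow_infsum_le p)

text \<open>The \<open>p\<close>-th powers of all terms \<open>c n i * atom i x\<close> have a
  finite total integral, so for almost every \<open>x\<close> the double family is absolutely
  summable and the order of summation is free. This is countable linearity of synthesis.\<close>

lemma synthesis_infsum:
  fixes c :: "nat \<Rightarrow> nat \<times> (int ^ 'n) \<Rightarrow> complex"
  assumes fin: "(\<integral>\<^sup>+n. coeff_sum p (c n) \<partial>count_space UNIV) < top"
  shows "coeff_sum p (\<lambda>i. \<Sum>\<^sub>\<infinity>n. c n i) \<le> (\<integral>\<^sup>+n. coeff_sum p (c n) \<partial>count_space UNIV)"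
    and "AE x in lebesgue. (\<lambda>n. S (c n) x) sums S (\<lambda>i. \<Sum>\<^sub>\<infinity>n. c n i) x"
proof -
  have "coeff_sum p (\<lambda>i. \<Sum>\<^sub>\<infinity>n. c n i) \<le> (\<integral>\<^sup>+i. \<integral>\<^sup>+n. ppow p (c n i) \<partial>count_space UNIV \<partial>count_space I)"
    unfolding coeff_sum_def by (intro nn_integral_mono ppow_infsum_le p)
  also have "\<dots> = (\<integral>\<^sup>+n. coeff_sum p (c n) \<partial>count_space UNIV)"
    unfolding coeff_sum_def by (rule nn_integral_count_space_nn_integral) auto
  finally show "coeff_sum p (\<lambda>i. \<Sum>\<^sub>\<infinity>n. c n i) \<le> (\<integral>\<^sup>+n. coeff_sum p (c n) \<partial>count_space UNIV)" .
  let ?E = "\<lambda>x. \<integral>\<^sup>+n. \<integral>\<^sup>+i. ppow p (c n i * atom i x) \<partial>count_space I \<partial>count_space UNIV"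
  have m: "(\<lambda>x. \<integral>\<^sup>+i. ppow p (c n i * atom i x) \<partial>count_space I) \<in> borel_measurable lebesgue" for n
    by (intro measurable_nn_integral_count_space countable_scale_shift_index measurable_coeff_atom)
  have "(\<integral>\<^sup>+x. ?E x \<partial>lebesgue) = (\<integral>\<^sup>+n. coeff_sum p (c n) * (\<integral>\<^sup>+x. ppow p (\<psi> x) \<partial>lebesgue) \<partial>count_space UNIV)"
    by (subst nn_integral_count_space_nn_integral) (simp_all add: m nn_integral_coeff_atoms)
  also have "\<dots> < top" using fin \<psi>_fin by (simp add: nn_integral_multc ennreal_mult_less_top)
  finally have E_fin: "(\<integral>\<^sup>+x. ?E x \<partial>lebesgue) < top" .
  have "?E \<in> borel_measurable lebesgue"
    by (rule measurable_nn_integral_count_space[OF _ m]) simp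
  from nn_integral_PInf_AE[OF this] have "AE x in lebesgue. ?E x \<noteq> \<infinity>"
    using E_fin by simp
  then show "AE x in lebesgue. (\<lambda>n. S (c n) x) sums S (\<lambda>i. \<Sum>\<^sub>\<infinity>n. c n i) x"
  proof eventually_elim
    case (elim x)
    have "(\<integral>\<^sup>+z. ppow p (c (fst z) (snd z) * atom (snd z) x) \<partial>count_space (UNIV \<times> I)) < top"
      using elim nn_integral_count_space_Times[of UNIV I "\<lambda>n i. ppow p (c n i * atom i x)"] by (simp add: less_top)
    then have sum: "(\<lambda>(n, i). c n i * atom i x) summable_on UNIV \<times> I"
      unfolding split_beta by (rule summable_ppow[OF p])
    have "(\<integral>\<^sup>+n. ppow p (S (c n) x) \<partial>count_space UNIV) \<le> ?E x"
      unfolding synthesis_eq by (intro nn_integral_mono ppow_infsum_le p)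
    then have "(\<lambda>n. S (c n) x) summable_on UNIV"
      using elim by (intro summable_ppow[OF p]) (auto simp: less_top top_unique)
    then have "(\<lambda>n. S (c n) x) sums (\<Sum>\<^sub>\<infinity>n. S (c n) x)"
      by (intro has_sum_imp_sums has_sum_infsum)
    also have "(\<Sum>\<^sub>\<infinity>n. S (c n) x) = (\<Sum>\<^sub>\<infinity>i\<in>I. \<Sum>\<^sub>\<infinity>n. c n i * atom i x)"
      unfolding synthesis_eq by (rule infsum_swap_banach[OF sum])
    also have "\<dots> = S (\<lambda>i. \<Sum>\<^sub>\<infinity>n. c n i) x"
      by (simp add: synthesis_eq infsum_cmult_left')
    finally show ?case .
  qed
qed

text \<open>The approximation is repeated on the remainders, whose integrals decay like \<delta> ^
  n. The n-th coefficient family costs at most K * \<delta> ^ n times the integral for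
  \<open>f\<close>, and the geometric series yields K / (1 - \<delta>).\<close>

lemma synthesis_of_approximate_synthesis:
  fixes K \<delta> :: real
  assumes K: "0 \<le> K" and \<delta>: "0 \<le> \<delta>" "\<delta> < 1"
    and step: "\<And>f. f \<in> borel_measurable lebesgue \<Longrightarrow> (\<integral>\<^sup>+x. ppow p (f x) \<partial>lebesgue) < top \<Longrightarrow>
      \<exists>c. coeff_sum p c \<le> ennreal K * (\<integral>\<^sup>+x. ppow p (f x) \<partial>lebesgue) \<and>
          (\<integral>\<^sup>+x. ppow p (f x - S c x) \<partial>lebesgue) \<le> ennreal \<delta> * (\<integral>\<^sup>+x. ppow p (f x) \<partial>lebesgue)"
    and f: "f \<in> borel_measurable lebesgue" and f_fin: "(\<integral>\<^sup>+x. ppow p (f x) \<partial>lebesgue) < top"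
  obtains c where "AE x in lebesgue. f x = S c x"
    "coeff_sum p c \<le> ennreal (K / (1 - \<delta>)) * (\<integral>\<^sup>+x. ppow p (f x) \<partial>lebesgue)"
proof -
  let ?X = "\<integral>\<^sup>+x. ppow p (f x) \<partial>lebesgue"
  obtain C where C: "\<And>h. h \<in> borel_measurable lebesgue \<Longrightarrow> (\<integral>\<^sup>+x. ppow p (h x) \<partial>lebesgue) < top \<Longrightarrow>
      coeff_sum p (C h) \<le> ennreal K * (\<integral>\<^sup>+x. ppow p (h x) \<partial>lebesgue) \<and>
      (\<integral>\<^sup>+x. ppow p (h x - S (C h) x) \<partial>lebesgue) \<le> ennreal \<delta> * (\<integral>\<^sup>+x. ppow p (h x) \<partial>lebesgue)"
  proof -
    \<comment> \<open>With the conditions on \<open>h\<close> as premises the predicate is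
      satisfiable for every \<open>h\<close>, which gives one global choice function for the
      recursion.\<close>
    let ?P = "\<lambda>h c. h \<in> borel_measurable lebesgue \<longrightarrow> (\<integral>\<^sup>+x. ppow p (h x) \<partial>lebesgue) < top \<longrightarrow>
      coeff_sum p c \<le> ennreal K * (\<integral>\<^sup>+x. ppow p (h x) \<partial>lebesgue) \<and>
      (\<integral>\<^sup>+x. ppow p (h x - S c x) \<partial>lebesgue) \<le> ennreal \<delta> * (\<integral>\<^sup>+x. ppow p (h x) \<partial>lebesgue)"
    have "\<exists>c. ?P h c" for h using step[of h] by blast
    then have "?P h (SOME c. ?P h c)" for h by (rule someI_ex)
    then show ?thesis by (intro that[of "\<lambda>h. SOME c. ?P h c"]) blast+
  qed
  define F where "F = rec_nat f (\<lambda>_ h x. h x - S (C h) x)"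
  have F_0: "F 0 = f" and F_Suc: "F (Suc n) = (\<lambda>x. F n x - S (C (F n)) x)" for n
    by (simp_all add: F_def)
  have F_m: "F n \<in> borel_measurable lebesgue" for n
    by (induction n) (auto simp: F_0 F_Suc f intro!: borel_measurable_diff measurable_synthesis)
  have F_le: "(\<integral>\<^sup>+x. ppow p (F n x) \<partial>lebesgue) \<le> ennreal (\<delta> ^ n) * ?X" for n
  proof (induction n)
    case (Suc n)
    have "(\<integral>\<^sup>+x. ppow p (F n x) \<partial>lebesgue) < top"
      using Suc f_fin by (auto simp: ennreal_mult_less_top intro: order.strict_trans1)
    then have "(\<integral>\<^sup>+x. ppow p (F (Suc n) x) \<partial>lebesgue) \<le> ennreal \<delta> * (\<integral>\<^sup>+x. ppow p (F n x) \<partial>lebesgue)"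
      using C[OF F_m[of n]] by (simp add: F_Suc)
    also have "\<dots> \<le> ennreal \<delta> * (ennreal (\<delta> ^ n) * ?X)"
      by (intro mult_left_mono Suc) simp
    finally show ?case using \<delta> by (simp add: ennreal_mult mult.assoc)
  qed (simp add: F_0)
  have F_fin: "(\<integral>\<^sup>+x. ppow p (F n x) \<partial>lebesgue) < top" for n
    using F_le[of n] f_fin by (auto simp: ennreal_mult_less_top intro: order.strict_trans1)
  have geo: "(\<integral>\<^sup>+n. ennreal (\<delta> ^ n) \<partial>count_space UNIV) = ennreal (1 / (1 - \<delta>))"
  proof -
    have "summable (\<lambda>n. \<delta> ^ n)" using \<delta> by (intro summable_geometric) simp
    then have "(\<Sum>n. ennreal (\<delta> ^ n)) = ennreal (\<Sum>n. \<delta> ^ n)"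
      using \<delta> by (intro suminf_ennreal2) auto
    also have "(\<Sum>n. \<delta> ^ n) = 1 / (1 - \<delta>)" using \<delta> by (intro suminf_geometric) simp
    finally show ?thesis by (simp only: nn_integral_count_space_nat)
  qed
  define c where "c n = C (F n)" for n
  have c_le: "coeff_sum p (c n) \<le> ennreal K * (ennreal (\<delta> ^ n) * ?X)" for n
    using C[OF F_m F_fin, of n] mult_left_mono[OF F_le[of n], of "ennreal K"] by (auto simp: c_def)
  have "(\<integral>\<^sup>+n. coeff_sum p (c n) \<partial>count_space UNIV) \<le> (\<integral>\<^sup>+n. ennreal K * (ennreal (\<delta> ^ n) * ?X) \<partial>count_space UNIV)"
    by (intro nn_integral_mono c_le)
  also have "\<dots> = ennreal K * (ennreal (1 / (1 - \<delta>)) * ?X)"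
    by (simp add: nn_integral_cmult nn_integral_multc geo)
  also have "\<dots> = ennreal (K / (1 - \<delta>)) * ?X"
    using \<delta> K by (simp flip: mult.assoc ennreal_mult)
  finally have c_sum: "(\<integral>\<^sup>+n. coeff_sum p (c n) \<partial>count_space UNIV) \<le> ennreal (K / (1 - \<delta>)) * ?X" .
  also have "\<dots> < top" using f_fin by (simp add: ennreal_mult_less_top)
  finally have c_fin: "(\<integral>\<^sup>+n. coeff_sum p (c n) \<partial>count_space UNIV) < top" .
  note [measurable] = measurable_ppow[OF p] F_m
  \<comment> \<open>The integrals of the remainders are summable, which is stronger than convergence
    to 0: it makes \<open>F n x\<close> summable in \<open>n\<close>, hence convergent to 0, for
    almost every \<open>x\<close>.\<close>
  have "(\<integral>\<^sup>+x. \<integral>\<^sup>+n. ppow p (F n x) \<partial>count_space UNIV \<partial>lebesgue) = (\<integral>\<^sup>+n. \<integral>\<^sup>+x. ppow p (F n x) \<partial>lebesgue \<partial>count_space UNIV)"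
    by (rule nn_integral_count_space_nn_integral) auto
  also have "\<dots> \<le> (\<integral>\<^sup>+n. ennreal (\<delta> ^ n) * ?X \<partial>count_space UNIV)"
    by (intro nn_integral_mono F_le)
  also have "\<dots> < top" using f_fin by (simp add: nn_integral_multc geo ennreal_mult_less_top)
  finally have "AE x in lebesgue. (\<integral>\<^sup>+n. ppow p (F n x) \<partial>count_space UNIV) \<noteq> \<infinity>"
    by (intro nn_integral_PInf_AE measurable_nn_integral_count_space) auto
  then have "AE x in lebesgue. f x = S (\<lambda>i. \<Sum>\<^sub>\<infinity>n. c n i) x"
    using synthesis_infsum(2)[OF c_fin]
  proof eventually_elim
    case (elim x)
    have "(\<lambda>n. F n x) summable_on UNIV"
      using elim(1) by (intro summable_ppow[OF p]) (simp add: less_top)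
    then have "(\<lambda>n. F n x) \<longlonglongrightarrow> 0" by (intro summable_LIMSEQ_zero summable_on_imp_summable)
    then have lim: "(\<lambda>N. f x - F N x) \<longlonglongrightarrow> f x" by (auto intro!: tendsto_eq_intros)
    \<comment> \<open>By the recursion the partial sums telescope.\<close>
    have "(\<Sum>n<N. S (c n) x) = f x - F N x" for N
      by (induction N) (simp_all add: F_0 F_Suc c_def)
    then have "(\<lambda>n. S (c n) x) sums f x" using lim by (simp add: sums_def)
    with elim(2) show ?case by (rule sums_unique2[symmetric])
  qed
  moreover have "coeff_sum p (\<lambda>i. \<Sum>\<^sub>\<infinity>n. c n i) \<le> ennreal (K / (1 - \<delta>)) * ?X"
    using synthesis_infsum(1)[OF c_fin] c_sum by (rule order_trans)
  ultimately show ?thesis by (rule that)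
qed

end

section \<open>Approximation by a single scale\<close>

lemma synthesis_single_scale:
  assumes J: "0 < J" and c: "\<And>j k. j \<noteq> J \<Longrightarrow> c (j, k) = 0"
  shows "synthesis p a b \<psi> c x = (\<Sum>\<^sub>\<infinity>k. c (J, k) * affine_atom p a b \<psi> J k x)"
proof -
  have "synthesis p a b \<psi> c x = (\<Sum>\<^sub>\<infinity>i\<in>Pair J ` UNIV. c i * affine_atom p a b \<psi> (fst i) (snd i) x)"
    unfolding synthesis_eq using J c by (intro infsum_cong_neutral) (auto simp: scale_shift_index_def)
  then show ?thesis by (simp add: infsum_reindex inj_on_def comp_def)
qed

lemma coeff_sum_single_scale:
  assumes p: "0 < p" "p \<le> 1" and J: "0 < J" and c: "\<And>j k. j \<noteq> J \<Longrightarrow> c (j, k) = 0"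
  shows "coeff_sum p c = (\<integral>\<^sup>+k. ppow p (c (J, k)) \<partial>count_space UNIV)"
proof -
  have "coeff_sum p c = (\<integral>\<^sup>+j. (\<integral>\<^sup>+k. ppow p (c (j, k)) \<partial>count_space UNIV) \<partial>count_space {0<..})"
    unfolding coeff_sum_def scale_shift_index_def
    using nn_integral_count_space_Times[of "{0<..}" UNIV "\<lambda>j k. ppow p (c (j, k))"] by simp
  also have "\<dots> = (\<integral>\<^sup>+j. (\<integral>\<^sup>+k. ppow p (c (J, k)) \<partial>count_space UNIV) * indicator {J} j \<partial>count_space {0<..})"
    using c by (intro nn_integral_cong) (auto simp: indicator_def ppow_0[OF p])
  finally show ?thesis using J by (simp add: nn_integral_cmult_indicator)
qed

context affine_system
begin

text \<open>Neither constant involves \<open>f\<close> or \<open>a\<close>, which is what makes the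
  final constants uniform. The contraction factor is the midpoint of \<theta> and 1; the distance to
  \<theta> absorbs the approximation errors.\<close>

lemma approximate_synthesis:
  fixes l :: complex and \<theta> :: real
  assumes b: "invertible b"
    and a_lim: "(\<lambda>j. onorm (\<lambda>x. matrix_inv (a j) *v x)) \<longlonglongrightarrow> 0"
    and \<theta>: "0 \<le> \<theta>" "\<theta> < 1"
      "(\<integral>\<^sup>+x. ppow p (l * periodization b \<psi> (b *v x) - 1) * indicator unit_cell x \<partial>lebesgue) = ennreal \<theta>"
    and f: "f \<in> borel_measurable lebesgue" and f_fin: "(\<integral>\<^sup>+x. ppow p (f x) \<partial>lebesgue) < top"
  shows "\<exists>c. coeff_sum p c \<le> ennreal (2 * cmod (l * of_real \<bar>det b\<bar>) powr p / \<bar>det b\<bar>) * (\<integral>\<^sup>+x. ppow p (f x) \<partial>lebesgue) \<and>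
     (\<integral>\<^sup>+x. ppow p (f x - S c x) \<partial>lebesgue) \<le> ennreal ((1 + \<theta>) / 2) * (\<integral>\<^sup>+x. ppow p (f x) \<partial>lebesgue)"
proof -
  obtain X where X: "0 \<le> X" "(\<integral>\<^sup>+x. ppow p (f x) \<partial>lebesgue) = ennreal X"
    using f_fin by (cases "\<integral>\<^sup>+x. ppow p (f x) \<partial>lebesgue") auto
  \<comment> \<open>The tolerance \<open>e\<close> below is a fraction of \<open>X\<close> and must
    be positive, so functions vanishing almost everywhere are treated apart.\<close>
  show ?thesis
  proof (cases "X = 0")
    case True
    have "S (\<lambda>_. 0) x = 0" for x by (simp add: synthesis_eq)
    then show ?thesis using X True by (intro exI[of _ "\<lambda>_. 0"]) (simp add: coeff_sum_def ppow_0[OF p])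
  next
    case False
    define \<mu> where "\<mu> = l * of_real \<bar>det b\<bar>"
    \<comment> \<open>Both \<open>b\<close> and the factor \<open>l\<close> are absorbed, so that
      the integer translates of \<phi> sum to
      \<open>l * periodization b \<psi> (b *v x)\<close>.\<close>
    define \<phi> where "\<phi> x = \<mu> * \<psi> (b *v x)" for x
    \<comment> \<open>The final estimate collects at most five errors \<open>e\<close>, and 5 * e is
      the gap between \<theta> * X and (1 + \<theta>) / 2 * X.\<close>
    define e where "e = X * (1 - \<theta>) / 10"
    have e: "0 < e" "e + e \<le> X" using False X \<theta> mult_left_le[of "1 - \<theta>" X] by (auto simp: e_def)
    note [measurable] = measurable_ppow[OF p] \<psi> f
    have \<psi>b [measurable]: "(\<lambda>x. \<psi> (b *v x)) \<in> borel_measurable lebesgue"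
      by (rule measurable_compose[OF measurable_lebesgue_linear[OF b] \<psi>])
    have \<phi> [measurable]: "\<phi> \<in> borel_measurable lebesgue" unfolding \<phi>_def by measurable
    have db: "det b \<noteq> 0" using b by (simp add: invertible_det_nz)
    have "(\<integral>\<^sup>+x. ppow p (\<psi> x) \<partial>lebesgue) = ennreal \<bar>det b\<bar> * (\<integral>\<^sup>+x. ppow p (\<psi> (b *v x)) \<partial>lebesgue)"
      by (rule nn_integral_lebesgue_linear[OF b]) measurable
    then have "(\<integral>\<^sup>+x. ppow p (\<psi> (b *v x)) \<partial>lebesgue) < top"
      using \<psi>_fin db by (auto simp: ennreal_mult_less_top)
    then have \<phi>_fin: "(\<integral>\<^sup>+x. ppow p (\<phi> x) \<partial>lebesgue) < top"
      by (simp add: \<phi>_def ppow_mult[OF p] nn_integral_cmult ennreal_mult_less_top ppow_less_top[OF p])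
    have "(\<Sum>\<^sub>\<infinity>k. \<phi> (x - of_int_vec k)) = l * periodization b \<psi> (b *v x)" for x
      by (simp add: \<phi>_def \<mu>_def periodization_def matrix_vector_mult_diff_distrib infsum_cmult_right' mult.assoc)
    then have \<theta>': "ennreal \<theta> = (\<integral>\<^sup>+x. ppow p ((\<Sum>\<^sub>\<infinity>k. \<phi> (x - of_int_vec k)) - 1) * indicator unit_cell x \<partial>lebesgue)"
      using \<theta>(3) by simp
    obtain g R M where g: "continuous_on UNIV g" "\<And>x. R \<le> norm x \<Longrightarrow> g x = 0" "\<And>x. cmod (g x) \<le> M"
      "(\<integral>\<^sup>+x. ppow p (f x - g x) \<partial>lebesgue) < ennreal e"
      using dense_continuous_compact_support[OF p f f_fin, of "ennreal e"] e by (auto simp: ennreal_less_zero_iff)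
    \<comment> \<open>The shift to \<open>Suc j\<close> ensures a positive scale, where
      \<open>a\<close> is invertible.\<close>
    define T where "T j = matrix_inv (a (Suc j)) ** b" for j
    define r where "r j = onorm (\<lambda>x. matrix_inv (a (Suc j)) *v x) * onorm (\<lambda>x. b *v x)" for j
    interpret cell_sampling p T r g R M
    proof
      show "invertible (T j)" for j
        unfolding T_def by (intro invertible_mult invertible_matrix_inv a_inv b) simp
      show "norm (T j *v y) \<le> r j * norm y" for j y
      proof -
        have "norm (T j *v y) \<le> onorm (\<lambda>x. matrix_inv (a (Suc j)) *v x) * norm (b *v y)"
          unfolding T_def matrix_vector_mul_assoc[symmetric] by (intro onorm) simp
        also have "\<dots> \<le> onorm (\<lambda>x. matrix_inv (a (Suc j)) *v x) * (onorm (\<lambda>x. b *v x) * norm y)"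
          by (intro mult_left_mono onorm onorm_pos_le) simp_all
        finally show ?thesis by (simp add: r_def mult.assoc)
      qed
      show "r \<longlonglongrightarrow> 0"
        unfolding r_def by (intro tendsto_mult_left_zero LIMSEQ_Suc a_lim)
    qed (use p g in auto)
    obtain j where j1: "ennreal \<bar>det (T j)\<bar> * (\<integral>\<^sup>+n. ppow p (g (T j *v of_int_vec n)) \<partial>count_space UNIV)
        \<le> (\<integral>\<^sup>+x. ppow p (g x) \<partial>lebesgue) + ennreal e"
      and j2: "(\<integral>\<^sup>+x. ppow p (g x - (\<Sum>\<^sub>\<infinity>k. g (T j *v of_int_vec k) * \<phi> (matrix_inv (T j) *v x - of_int_vec k))) \<partial>lebesgue)
        \<le> ((\<integral>\<^sup>+x. ppow p (g x) \<partial>lebesgue) + ennreal e) * ennreal \<theta> + ennreal e + ennreal e"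
      using single_scale_approximation[OF \<phi> \<phi>_fin \<theta>', of "ennreal e"] e by (auto simp: eventually_sequentially)
    define J where "J = Suc j"
    have J: "0 < J" by (simp add: J_def)
    have aJ: "invertible (a J)" using J by (rule a_inv)
    have dJ: "det (a J) \<noteq> 0" using aJ by (simp add: invertible_det_nz)
    \<comment> \<open>The negative power cancels the normalization of the atoms and \<mu> is the
      factor contained in \<phi>, so \<open>S c\<close> is exactly the sampled sum.\<close>
    define c where "c = (\<lambda>(j', k). if j' = J then \<mu> * of_real (\<bar>det (a J)\<bar> powr (- 1 / p)) * g (T j *v of_int_vec k) else 0)"
    have c0: "j' \<noteq> J \<Longrightarrow> c (j', k) = 0" for j' k by (simp add: c_def)
    have [measurable]: "g \<in> borel_measurable lebesgue" by (rule measurable_g)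
    have g_le: "(\<integral>\<^sup>+x. ppow p (g x) \<partial>lebesgue) \<le> ennreal (X + e)"
    proof -
      have "(\<integral>\<^sup>+x. ppow p (g x) \<partial>lebesgue) \<le> (\<integral>\<^sup>+x. ppow p (f x) + ppow p (f x - g x) \<partial>lebesgue)"
        by (intro nn_integral_mono order_trans[OF eq_refl ppow_diff_le[OF p]]) simp
      also have "\<dots> = (\<integral>\<^sup>+x. ppow p (f x) \<partial>lebesgue) + (\<integral>\<^sup>+x. ppow p (f x - g x) \<partial>lebesgue)"
        by (rule nn_integral_add) auto
      also have "\<dots> \<le> ennreal X + ennreal e" using X g(4) by (intro add_mono) auto
      finally show ?thesis using X e by simp
    qed
    have N_le: "ennreal \<bar>det (T j)\<bar> * (\<integral>\<^sup>+n. ppow p (g (T j *v of_int_vec n)) \<partial>count_space UNIV) \<le> ennreal (2 * X)"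
    proof -
      have "(\<integral>\<^sup>+x. ppow p (g x) \<partial>lebesgue) + ennreal e \<le> ennreal (X + e) + ennreal e"
        using g_le by (rule add_right_mono)
      \<comment> \<open>The factor 2 of the coefficient bound arises here, from X + 2 * e \<le> 2 *
        X.\<close>
      also have "\<dots> \<le> ennreal (2 * X)" using X e by (simp add: ennreal_leI flip: ennreal_plus)
      finally show ?thesis using j1 by (rule order_trans[rotated])
    qed
    have det_T: "\<bar>det (T j)\<bar> = \<bar>det b\<bar> / \<bar>det (a J)\<bar>"
      by (simp add: T_def det_mul det_matrix_inv[OF aJ[unfolded J_def]] J_def)
    have "coeff_sum p c = (\<integral>\<^sup>+k. ppow p (\<mu> * of_real (\<bar>det (a J)\<bar> powr (- 1 / p))) * ppow p (g (T j *v of_int_vec k)) \<partial>count_space UNIV)"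
      by (subst coeff_sum_single_scale[where c = c, OF p J c0]) (simp_all add: c_def ppow_mult[OF p])
    also have "\<dots> = ppow p (\<mu> * of_real (\<bar>det (a J)\<bar> powr (- 1 / p))) * (\<integral>\<^sup>+k. ppow p (g (T j *v of_int_vec k)) \<partial>count_space UNIV)"
      by (simp add: nn_integral_cmult)
    \<comment> \<open>The weight of a coefficient is the cell volume up to a constant, since 1 /
      |det (a J)| = |det (T j)| / |det b|. So the coefficient sum is controlled by an
      integral.\<close>
    also have "ppow p (\<mu> * of_real (\<bar>det (a J)\<bar> powr (- 1 / p))) = ennreal (cmod \<mu> powr p / \<bar>det b\<bar>) * ennreal \<bar>det (T j)\<bar>"
    proof -
      have "(\<bar>det (a J)\<bar> powr (- 1 / p)) powr p = 1 / \<bar>det (a J)\<bar>"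
        unfolding powr_powr using p dJ by (simp add: powr_minus_divide)
      then have "cmod (\<mu> * of_real (\<bar>det (a J)\<bar> powr (- 1 / p))) powr p = cmod \<mu> powr p / \<bar>det b\<bar> * \<bar>det (T j)\<bar>"
        using db by (simp add: norm_mult powr_mult det_T del: powr_powr)
      then show ?thesis by (simp add: ppow_def flip: ennreal_mult)
    qed
    finally have "coeff_sum p c \<le> ennreal (cmod \<mu> powr p / \<bar>det b\<bar>) * ennreal (2 * X)"
      using mult_left_mono[OF N_le, of "ennreal (cmod \<mu> powr p / \<bar>det b\<bar>)"] by (simp add: mult.assoc)
    also have "\<dots> = ennreal (2 * cmod \<mu> powr p / \<bar>det b\<bar>) * ennreal X"
      using X by (simp add: mult_ac flip: ennreal_mult)
    finally have c_le: "coeff_sum p c \<le> ennreal (2 * cmod \<mu> powr p / \<bar>det b\<bar>) * ennreal X" .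
    have S_eq: "S c x = (\<Sum>\<^sub>\<infinity>k. g (T j *v of_int_vec k) * \<phi> (matrix_inv (T j) *v x - of_int_vec k))" for x
    proof -
      have "matrix_inv (a J) *v (b *v (matrix_inv (T j) *v x)) = x"
        using matrix_inv_cancel(1)[OF T[of j], of x] by (simp add: T_def J_def matrix_vector_mul_assoc matrix_mul_assoc)
      \<comment> \<open>In lattice coordinates the argument of an atom is \<open>b\<close> applied
        to an integer translate, which is the form in which \<phi> enters.\<close>
      then have *: "b *v (matrix_inv (T j) *v x) = a J *v x"
        using matrix_inv_cancel(1)[OF aJ] by metis
      have "of_real (\<bar>det (a J)\<bar> powr (- 1 / p)) * of_real (\<bar>det (a J)\<bar> powr (1 / p)) = (1 :: complex)"
        using dJ by (simp flip: of_real_mult powr_add)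
      then have "c (J, k) * affine_atom p a b \<psi> J k x = g (T j *v of_int_vec k) * \<phi> (matrix_inv (T j) *v x - of_int_vec k)" for k
        by (simp add: c_def affine_atom_def \<phi>_def matrix_vector_mult_diff_distrib * algebra_simps)
      then show ?thesis by (subst synthesis_single_scale[where c = c, OF J c0]) simp_all
    qed
    note [measurable] = measurable_synthesis
    have "(\<integral>\<^sup>+x. ppow p (f x - S c x) \<partial>lebesgue) \<le> (\<integral>\<^sup>+x. ppow p (f x - g x) + ppow p (g x - S c x) \<partial>lebesgue)"
      by (intro nn_integral_mono order_trans[OF eq_refl ppow_add_le[OF p]]) simp
    also have "\<dots> = (\<integral>\<^sup>+x. ppow p (f x - g x) \<partial>lebesgue) + (\<integral>\<^sup>+x. ppow p (g x - S c x) \<partial>lebesgue)"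
      by (rule nn_integral_add) auto
    also have "\<dots> \<le> ennreal e + ((ennreal (X + e) + ennreal e) * ennreal \<theta> + ennreal e + ennreal e)"
      using g(4) j2 g_le unfolding S_eq
      by (intro add_mono order_trans[OF j2] mult_right_mono) auto
    also have "\<dots> = ennreal (e + ((X + e + e) * \<theta> + e + e))"
      using X e \<theta> by (simp flip: ennreal_plus ennreal_mult)
    also have "\<dots> \<le> ennreal ((1 + \<theta>) / 2 * X)"
    proof (rule ennreal_leI)
      have "(e + e) * \<theta> \<le> e + e" using e \<theta> by (intro mult_left_le) auto
      then have "e + ((X + e + e) * \<theta> + e + e) \<le> X * \<theta> + 5 * e" by (simp add: algebra_simps)
      also have "\<dots> = (1 + \<theta>) / 2 * X" by (simp add: e_def field_simps)
      finally show "e + ((X + e + e) * \<theta> + e + e) \<le> (1 + \<theta>) / 2 * X" .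
    qed
    finally have "(\<integral>\<^sup>+x. ppow p (f x - S c x) \<partial>lebesgue) \<le> ennreal ((1 + \<theta>) / 2) * ennreal X"
      using X \<theta> by (simp flip: ennreal_mult)
    with c_le show ?thesis unfolding X(2) \<mu>_def by blast
  qed
qed

end

text \<open>\<open>Lp_norm\<close> is 0 for a measurable function outside L^p, so the hypothesis
  alone does not bound the integral. Finiteness is proved first, by subadditivity and unfolding of
  the cell; then the inequality between real numbers carries over.\<close>

lemma periodization_defect_less_1:
  fixes b :: "real ^ 'n ^ 'n" and l :: complex
  assumes p: "0 < p" "p \<le> 1" and b: "invertible b"
    and \<psi>: "\<psi> \<in> borel_measurable lebesgue" and \<psi>_fin: "(\<integral>\<^sup>+x. ppow p (\<psi> x) \<partial>lebesgue) < top"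
    and less: "Lp_norm (lebesgue_on unit_cell) p (\<lambda>x. l * periodization b \<psi> (b *v x) - 1) < 1"
  obtains \<theta> where "0 \<le> \<theta>" "\<theta> < 1"
    "(\<integral>\<^sup>+x. ppow p (l * periodization b \<psi> (b *v x) - 1) * indicator unit_cell x \<partial>lebesgue) = ennreal \<theta>"
proof -
  let ?h = "\<lambda>x. l * periodization b \<psi> (b *v x) - 1"
  note [measurable] = measurable_ppow[OF p] \<psi>
  have [measurable]: "(\<lambda>x. \<psi> (b *v x)) \<in> borel_measurable lebesgue"
    by (rule measurable_compose[OF measurable_lebesgue_linear[OF b] \<psi>])
  then have sh [measurable]: "(\<lambda>x. \<psi> (b *v (x - of_int_vec k))) \<in> borel_measurable lebesgue" for k
    by (rule measurable_lebesgue_diff)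
  have P: "periodization b \<psi> (b *v x) = of_real \<bar>det b\<bar> * (\<Sum>\<^sub>\<infinity>k. \<psi> (b *v (x - of_int_vec k)))" for x
    by (simp add: periodization_def matrix_vector_mult_diff_distrib)
  have Pm: "(\<lambda>x. \<Sum>\<^sub>\<infinity>k. \<psi> (b *v (x - of_int_vec k))) \<in> borel_measurable lebesgue"
    by (rule measurable_infsum) auto
  have h [measurable]: "?h \<in> borel_measurable lebesgue"
    unfolding P using Pm by measurable
  have db: "det b \<noteq> 0" using b by (simp add: invertible_det_nz)
  have "(\<integral>\<^sup>+x. ppow p (\<psi> x) \<partial>lebesgue) = ennreal \<bar>det b\<bar> * (\<integral>\<^sup>+x. ppow p (\<psi> (b *v x)) \<partial>lebesgue)"
    by (rule nn_integral_lebesgue_linear[OF b]) measurable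
  then have \<psi>b_fin: "(\<integral>\<^sup>+x. ppow p (\<psi> (b *v x)) \<partial>lebesgue) < top"
    using \<psi>_fin db by (auto simp: ennreal_mult_less_top)
  have "(\<integral>\<^sup>+x. ppow p (?h x) * indicator unit_cell x \<partial>lebesgue) \<le>
     (\<integral>\<^sup>+x. ppow p (l * of_real \<bar>det b\<bar>) * (\<integral>\<^sup>+k. ppow p (\<psi> (b *v (x - of_int_vec k))) * indicator unit_cell x \<partial>count_space UNIV)
        + indicator unit_cell x \<partial>lebesgue)"
  proof (intro nn_integral_mono)
    fix x :: "real ^ 'n"
    have "ppow p (?h x) \<le> ppow p (l * periodization b \<psi> (b *v x)) + ppow p 1" by (rule ppow_diff_le[OF p])
    also have "\<dots> = ppow p (l * of_real \<bar>det b\<bar>) * ppow p (\<Sum>\<^sub>\<infinity>k. \<psi> (b *v (x - of_int_vec k))) + 1"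
      unfolding P by (simp add: ppow_mult[OF p, symmetric] mult.assoc) (simp add: ppow_def)
    also have "\<dots> \<le> ppow p (l * of_real \<bar>det b\<bar>) * (\<integral>\<^sup>+k. ppow p (\<psi> (b *v (x - of_int_vec k))) \<partial>count_space UNIV) + 1"
      by (intro add_right_mono mult_left_mono ppow_infsum_le p) simp
    finally show "ppow p (?h x) * indicator unit_cell x \<le> ppow p (l * of_real \<bar>det b\<bar>) *
        (\<integral>\<^sup>+k. ppow p (\<psi> (b *v (x - of_int_vec k))) * indicator unit_cell x \<partial>count_space UNIV) + indicator unit_cell x"
      by (auto simp: indicator_def)
  qed
  also have "\<dots> = ppow p (l * of_real \<bar>det b\<bar>) * (\<integral>\<^sup>+x. (\<integral>\<^sup>+k. ppow p (\<psi> (b *v (x - of_int_vec k))) * indicator unit_cell x \<partial>count_space UNIV) \<partial>lebesgue) + 1"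
    by (subst nn_integral_add)
       (auto intro!: measurable_nn_integral_count_space borel_measurable_times_ennreal simp: nn_integral_cmult measurable_nn_integral_count_space emeasure_unit_cell)
  also have "(\<integral>\<^sup>+x. (\<integral>\<^sup>+k. ppow p (\<psi> (b *v (x - of_int_vec k))) * indicator unit_cell x \<partial>count_space UNIV) \<partial>lebesgue) = (\<integral>\<^sup>+x. ppow p (\<psi> (b *v x)) \<partial>lebesgue)"
    by (subst nn_integral_count_space_nn_integral; (subst nn_integral_unit_cells_minus)?) auto
  also have "ppow p (l * of_real \<bar>det b\<bar>) * (\<integral>\<^sup>+x. ppow p (\<psi> (b *v x)) \<partial>lebesgue) + 1 < top"
    using \<psi>b_fin ppow_less_top[OF p] by (simp add: ennreal_mult_less_top)
  finally obtain \<theta> where \<theta>: "0 \<le> \<theta>" "(\<integral>\<^sup>+x. ppow p (?h x) * indicator unit_cell x \<partial>lebesgue) = ennreal \<theta>"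
    by (cases "\<integral>\<^sup>+x. ppow p (?h x) * indicator unit_cell x \<partial>lebesgue") auto
  have "(\<integral>\<^sup>+x. ppow p (?h x) \<partial>lebesgue_on unit_cell) = ennreal \<theta>"
    using \<theta>(2) by (subst nn_integral_restrict_space) auto
  moreover have "?h \<in> borel_measurable (lebesgue_on unit_cell)"
    using h by (rule measurable_restrict_space1)
  ultimately have "Lp_norm (lebesgue_on unit_cell) p ?h = \<theta> powr (1 / p)"
    using \<theta>(1) p by (subst Lp_norm_eq) auto
  then have "\<theta> powr (1 / p) < 1" using less by simp
  then have "\<theta> < 1"
    using p ge_one_powr_ge_zero[of \<theta> "1 / p"] by force
  with \<theta> show ?thesis by (intro that)
qed

theorem corollary7:
  fixes p :: real
    and b :: "real ^ 'n ^ 'n"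
    and \<psi> :: "real ^ 'n \<Rightarrow> complex"
  assumes "0 < p" and "p \<le> 1"
    and "invertible b"
    and "\<psi> \<in> Lp_space lebesgue p"
    and "\<exists>l::complex.
           Lp_norm (lebesgue_on unit_cell) p (\<lambda>x. l * periodization b \<psi> (b *v x) - 1) < 1"
  shows "\<exists>C1 C2 :: real. C1 > 0 \<and> C2 > 0 \<and>
           (\<forall>a :: nat \<Rightarrow> real ^ 'n ^ 'n.
              (\<forall>j>0. invertible (a j)) \<longrightarrow>
              (\<lambda>j. onorm (\<lambda>x. matrix_inv (a j) *v x)) \<longlonglongrightarrow> 0 \<longrightarrow>
              (\<forall>f \<in> Lp_space lebesgue p.
                 ereal (C1 * Lp_norm lebesgue p f) \<le> synthesis_norm p a b \<psi> f \<and>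
                 synthesis_norm p a b \<psi> f \<le> ereal (C2 * Lp_norm lebesgue p f)))"
proof -
  note p = assms(1,2)
  have \<psi>: "\<psi> \<in> borel_measurable lebesgue" and \<psi>_fin: "(\<integral>\<^sup>+x. ppow p (\<psi> x) \<partial>lebesgue) < top"
    using assms(4) by (simp_all add: Lp_space_iff[OF p(1)])
  obtain l where "Lp_norm (lebesgue_on unit_cell) p (\<lambda>x. l * periodization b \<psi> (b *v x) - 1) < 1"
    using assms(5) by blast
  from periodization_defect_less_1[OF p assms(3) \<psi> \<psi>_fin this]
  obtain \<theta> where \<theta>: "0 \<le> \<theta>" "\<theta> < 1"
    "(\<integral>\<^sup>+x. ppow p (l * periodization b \<psi> (b *v x) - 1) * indicator unit_cell x \<partial>lebesgue) = ennreal \<theta>"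
    by blast
  define K where "K = 2 * cmod (l * of_real \<bar>det b\<bar>) powr p / \<bar>det b\<bar>"
  \<comment> \<open>The total cost of the iteration with contraction factor (1 + \<theta>) /
    2.\<close>
  define Q where "Q = K / (1 - (1 + \<theta>) / 2)"
  have K: "0 \<le> K" by (simp add: K_def)
  have Q: "0 \<le> Q" using K \<theta> by (simp add: Q_def)
  obtain Y where Y: "0 \<le> Y" "(\<integral>\<^sup>+x. ppow p (\<psi> x) \<partial>lebesgue) = ennreal Y"
    using \<psi>_fin by (cases "\<integral>\<^sup>+x. ppow p (\<psi> x) \<partial>lebesgue") auto
  \<comment> \<open>The added 1 here and in \<open>C2\<close> makes both constants positive without
    a case distinction on \<open>Y\<close> or \<open>Q\<close>. They are fixed before
    \<open>a\<close> and \<open>f\<close> appear.\<close>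
  define C1 where "C1 = 1 / (Y + 1) powr (1 / p)"
  define C2 where "C2 = (Q + 1) powr (1 / p)"
  have C1: "0 < C1" using Y by (simp add: C1_def)
  have C2: "0 < C2" using Q by (simp add: C2_def)
  have "ereal (C1 * Lp_norm lebesgue p f) \<le> synthesis_norm p a b \<psi> f \<and>
        synthesis_norm p a b \<psi> f \<le> ereal (C2 * Lp_norm lebesgue p f)"
    if a: "\<forall>j>0. invertible (a j)" and a_lim: "(\<lambda>j. onorm (\<lambda>x. matrix_inv (a j) *v x)) \<longlonglongrightarrow> 0"
      and f: "f \<in> Lp_space lebesgue p" for a :: "nat \<Rightarrow> real ^ 'n ^ 'n" and f
  proof -
    interpret affine_system p a b \<psi>
      using p a \<psi> \<psi>_fin by unfold_locales auto
    have fm: "f \<in> borel_measurable lebesgue" and f_fin: "(\<integral>\<^sup>+x. ppow p (f x) \<partial>lebesgue) < top"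
      using f by (simp_all add: Lp_space_iff[OF p(1)])
    obtain X where X: "0 \<le> X" "(\<integral>\<^sup>+x. ppow p (f x) \<partial>lebesgue) = ennreal X"
      using f_fin by (cases "\<integral>\<^sup>+x. ppow p (f x) \<partial>lebesgue") auto
    have norm_f: "Lp_norm lebesgue p f = X powr (1 / p)"
      using Lp_norm_eq[OF p(1) fm] X by simp
    \<comment> \<open>The lower bound is shown for every representation, since it must pass to the
      infimum; the upper bound needs only one.\<close>
    have lower: "C1 * Lp_norm lebesgue p f \<le> lp_norm p c"
      if c: "c \<in> lp_space p" and fc: "AE x in lebesgue. f x = S c x" for c
    proof -
      obtain Z where Z: "0 \<le> Z" "coeff_sum p c = ennreal Z"
        using c by (cases "coeff_sum p c") (auto simp: lp_space_iff[OF p(1)])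
      have "ennreal X = (\<integral>\<^sup>+x. ppow p (S c x) \<partial>lebesgue)"
        unfolding X(2)[symmetric] using fc by (intro nn_integral_cong_AE) (auto elim: eventually_mono)
      also have "\<dots> \<le> ennreal (Z * Y)"
        using nn_integral_synthesis_le[of c] Z Y by (simp add: ennreal_mult)
      finally have "X \<le> Z * Y" using Z Y by simp
      also have "\<dots> \<le> Z * (Y + 1)" using Z by (intro mult_left_mono) auto
      finally have "X powr (1 / p) \<le> (Z * (Y + 1)) powr (1 / p)"
        using X p by (intro powr_mono2) auto
      also have "\<dots> = Z powr (1 / p) * (Y + 1) powr (1 / p)"
        using Z Y by (simp add: powr_mult)
      finally have "X powr (1 / p) / (Y + 1) powr (1 / p) \<le> Z powr (1 / p)"
        using Y by (simp add: divide_le_eq)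
      then show ?thesis using Z by (simp add: norm_f lp_norm_eq[OF p(1) c] C1_def)
    qed
    obtain c where c: "AE x in lebesgue. f x = S c x"
      "coeff_sum p c \<le> ennreal Q * (\<integral>\<^sup>+x. ppow p (f x) \<partial>lebesgue)"
      using synthesis_of_approximate_synthesis[OF K, of "(1 + \<theta>) / 2" f] \<theta>
        approximate_synthesis[OF assms(3) a_lim \<theta>] fm f_fin
      unfolding K_def[symmetric] Q_def by auto
    have c_le: "coeff_sum p c \<le> ennreal (Q * X)"
      using c(2) X Q by (simp add: ennreal_mult)
    then have c_lp: "c \<in> lp_space p"
      by (auto simp: lp_space_iff[OF p(1)] intro: order.strict_trans1)
    have "enn2real (coeff_sum p c) \<le> Q * X"
      using enn2real_mono[OF c_le] Q X by simp
    also have "\<dots> \<le> (Q + 1) * X" using X by (intro mult_right_mono) auto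
    finally have "lp_norm p c \<le> ((Q + 1) * X) powr (1 / p)"
      unfolding lp_norm_eq[OF p(1) c_lp] using p by (intro powr_mono2) auto
    also have "\<dots> = C2 * Lp_norm lebesgue p f"
      using Q X by (simp add: powr_mult norm_f C2_def)
    finally have upper: "lp_norm p c \<le> C2 * Lp_norm lebesgue p f" .
    show ?thesis
    proof
      show "ereal (C1 * Lp_norm lebesgue p f) \<le> synthesis_norm p a b \<psi> f"
        unfolding synthesis_norm_def using lower by (intro INF_greatest) auto
      have "synthesis_norm p a b \<psi> f \<le> ereal (lp_norm p c)"
        unfolding synthesis_norm_def using c(1) c_lp by (intro INF_lower) auto
      then show "synthesis_norm p a b \<psi> f \<le> ereal (C2 * Lp_norm lebesgue p f)"
        using upper by (metis ereal_less_eq(3) order_trans)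
    qed
  qed
  with C1 C2 show ?thesis by blast
qed

end
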